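(* Let $Q(z)=-\frac14 (z+i)^2(z^2-2iz-3)$, whose simple zeros are $z_1=-\sqrt2+i$ and $z_2=\sqrt2+i$ and which has a double zero at $-i$. There exists a critical trajectory $\gamma$ of the quadratic differential $Q(z)\,dz^2$ that connects the two zeros $z_1$ and $z_2$ of $Q$.
   Context: Convention: a trajectory of the quadratic differential $Q(z)\,dz^2$ is an analytic arc along which $Q(z)\,dz^2<0$, i.e. for a parametrization $z(t)$ one has $Q(z(t))\,z'(t)^2<0$. It is critical if it emanates from a zero of $Q$. Thus a critical trajectory connecting $z_1$ and $z_2$ is an analytic arc $\gamma$ from $z_1$ to $z_2$, containing no zero of $Q$ in its interior, such that $$\frac{1}{\pi i}\int_{z_1}^z Q^{1/2}(s)\,ds$$ is real for every $z\in\gamma$, where the integral is taken along $\gamma$ and $Q^{1/2}$ is a continuous branch of the square root of $Q$ along $\gamma$. *)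

theory Defs
  imports "HOL-Complex_Analysis.Complex_Analysis"
begin

text \<open>
  A (simple, closed, regular) analytic arc: the parametrization is injective on the closed interval
  and is the restriction to it of a function that is holomorphic in a complex neighbourhood and has
  nonvanishing derivative on the interval, endpoints included.
\<close>
definition analytic_arc :: "(real \<Rightarrow> complex) \<Rightarrow> bool" where
  "analytic_arc \<gamma> \<longleftrightarrow> arc \<gamma> \<and>
     (\<exists>f. f analytic_on (complex_of_real ` {0..1}) \<and>
          (\<forall>t\<in>{0..1}. \<gamma> t = f (complex_of_real t) \<and> deriv f (complex_of_real t) \<noteq> 0))"

text \<open>
  The inequality is imposed on the open arc only, since a trajectory
  may end at a zero of \<open>Q\<close>.
\<close>
definition trajectory :: "(complex \<Rightarrow> complex) \<Rightarrow> (real \<Rightarrow> complex) \<Rightarrow> bool" where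
  "trajectory Q \<gamma> \<longleftrightarrow> analytic_arc \<gamma> \<and>
     (\<forall>t\<in>{0<..<1}. Q (\<gamma> t) * (vector_derivative \<gamma> (at t))\<^sup>2 \<in> \<real> \<and>
                   Re (Q (\<gamma> t) * (vector_derivative \<gamma> (at t))\<^sup>2) < 0)"

text \<open>
  Both descriptions of a critical trajectory are required: the differential one (through
  \<^const>\<open>trajectory\<close>) and the one by integrals of a continuous branch \<open>R\<close> of the
  square root of \<open>Q\<close> along \<open>\<gamma>\<close>. Since \<open>\<gamma>\<close> is injective, the branch can be given as a function
  on the image of \<open>\<gamma>\<close>, and since \<open>\<gamma>\<close> is smooth, all the integrals exist.
\<close>
definition critical_trajectory_connecting ::
    "(complex \<Rightarrow> complex) \<Rightarrow> complex \<Rightarrow> complex \<Rightarrow> (real \<Rightarrow> complex) \<Rightarrow> bool" where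
  "critical_trajectory_connecting Q z\<^sub>1 z\<^sub>2 \<gamma> \<longleftrightarrow>
     trajectory Q \<gamma> \<and> pathstart \<gamma> = z\<^sub>1 \<and> pathfinish \<gamma> = z\<^sub>2 \<and>
     Q z\<^sub>1 = 0 \<and> Q z\<^sub>2 = 0 \<and> (\<forall>t\<in>{0<..<1}. Q (\<gamma> t) \<noteq> 0) \<and>
     (\<exists>R. continuous_on (path_image \<gamma>) R \<and> (\<forall>z\<in>path_image \<gamma>. (R z)\<^sup>2 = Q z) \<and>
          (\<forall>t\<in>{0..1}. 1 / (complex_of_real pi * \<i>) * contour_integral (subpath 0 t \<gamma>) R \<in> \<real>))"

end

theory Submission
  imports Defs
begin

text \<open>
  Put \<open>z = sqrt 2 * cos u + \<i>\<close>. Then \<open>z\<^sup>2 - 2 * \<i> * z - 3 = - 2 * (sin u)\<^sup>2\<close>, so the square root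
  of \<open>Q\<close> becomes single-valued in \<open>u\<close>, and its primitive along \<open>dz\<close> is, up to the factor
  \<open>\<plusminus> \<i> / 2\<close>, the entire function
  \<open>phase u = 2 * u - 2 * sin u * cos u - (2 * sqrt 2 / 3) * \<i> * (sin u)^3\<close>. The zeros \<open>z\<^sub>2\<close> and
  \<open>z\<^sub>1\<close> correspond to \<open>u = 0\<close> and \<open>u = pi\<close>, where \<open>phase\<close> takes the real values \<open>0\<close> and
  \<open>2 * pi\<close>. A trajectory from \<open>z\<^sub>1\<close> to \<open>z\<^sub>2\<close> is thus the image of an arc from \<open>pi\<close> to \<open>0\<close> on
  which \<open>phase\<close> is real and monotone.

  Existence of that arc (\<open>level_curve\<close>): on each vertical line \<open>Re u = x\<close> with \<open>0 < x < pi\<close> the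
  imaginary part of \<open>phase\<close> is negative on the real axis, increases upwards inside an explicit
  region (\<open>wedge\<close>), and is positive on the upper boundary of this region. It therefore vanishes
  exactly once there, and by compactness these zeros form a continuous graph over \<open>[0, pi]\<close>.
  Since \<open>phase\<close> is an open map, its real part has no local extremum along the graph, so it runs
  strictly from \<open>0\<close> to \<open>2 * pi\<close>.

  Analyticity needs care only at the two end points, where both \<open>cos\<close> and \<open>phase\<close> have critical
  points. These two ramifications are absorbed by one entire function \<open>H\<close> of \<open>c = cos u\<close> with
  \<open>H (cos u) = (cos (phase u / 4))\<^sup>2\<close> (\<open>uniformizing_function\<close>). It satisfies the algebraic
  differential equation \<open>(deriv H c)\<^sup>2 = - 2 * H c * (1 - H c) * Q (sqrt 2 * c + \<i>)\<close>. Counting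
  orders in this equation shows that \<open>H\<close> vanishes to order three at \<open>-1\<close>, and \<open>1 - H\<close> to order
  three at \<open>1\<close>. On the arc \<open>H\<close> increases from \<open>0\<close> to \<open>1\<close>; the arc is parametrized by
  \<open>H (g t) = smoothstep t\<close>, where the polynomial \<open>smoothstep\<close> has the same orders of contact at
  \<open>0\<close> and \<open>1\<close>. Taking cube roots on both sides at the end points, and nothing at the interior
  points, leaves an equation between local coordinates, so that \<open>g\<close> is analytic with
  nonvanishing derivative (\<open>local_lift\<close>). Differentiating \<open>H (g t) = smoothstep t\<close> and inserting
  the differential equation gives \<open>Q \<gamma>'\<^sup>2 = - q'\<^sup>2 / (q * (1 - q)) < 0\<close> for \<open>\<gamma> = sqrt 2 * g + \<i>\<close>
  and \<open>q = smoothstep\<close>.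
\<close>

section \<open>The phase on vertical lines\<close>

text \<open>
  Up to the sign of the square root, this is \<open>- 2 * \<i>\<close> times the primitive of the square root of
  \<open>Q\<close>, in the coordinate \<open>u\<close> with \<open>z = sqrt 2 * cos u + \<i>\<close>.
\<close>
definition phase :: "complex \<Rightarrow> complex" where
  "phase u = 2 * u - 2 * sin u * cos u - of_real (2 * sqrt 2 / 3) * \<i> * sin u ^ 3"

definition phase_im :: "real \<Rightarrow> real \<Rightarrow> real" where
  "phase_im x y = 2 * y - 2 * ((cos x)\<^sup>2 - (sin x)\<^sup>2) * sinh y * cosh y
     - 2 * sqrt 2 / 3 * ((sin x * cosh y) ^ 3 - 3 * (sin x * cosh y) * (cos x * sinh y)\<^sup>2)"

text \<open>
  The first condition is \<open>\<bar>Im (sin u)\<bar> \<le> \<bar>Re (sin u)\<bar>\<close> and the second is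
  \<open>Im (cos u) \<ge> - sqrt 2\<close>, at \<open>u = Complex x y\<close>. The first keeps \<open>(sin u)\<^sup>2\<close> in the closed right
  half plane; the second keeps \<open>cos u\<close> from descending below the value \<open>- \<i> * sqrt 2\<close> that
  corresponds to the double zero of \<open>Q\<close>. Together they make, for \<open>sin x \<ge> 0\<close> and \<open>y \<ge> 0\<close>, the
  real part of \<open>2 * (sin u)\<^sup>2 * (2 - sqrt 2 * \<i> * cos u)\<close>, which is the derivative of \<open>phase\<close>,
  nonnegative.
\<close>
definition wedge :: "real \<Rightarrow> real \<Rightarrow> bool" where
  "wedge x y \<longleftrightarrow> (cos x * sinh y)\<^sup>2 \<le> (sin x * cosh y)\<^sup>2 \<and> sin x * sinh y \<le> sqrt 2"

lemma sin_cos_Complex: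
  "sin (Complex x y) = Complex (sin x * cosh y) (cos x * sinh y)"
  "cos (Complex x y) = Complex (cos x * cosh y) (- (sin x * sinh y))"
  by (simp_all add: complex_eq_iff Re_sin Im_sin Re_cos Im_cos sinh_def cosh_def algebra_simps
      add_divide_distrib diff_divide_distrib)

lemma Im_phase: "Im (phase (Complex x y)) = phase_im x y"
proof -
  have cube: "Re (Complex a b ^ 3) = a ^ 3 - 3 * a * b\<^sup>2" for a b
    by (simp add: power3_eq_cube power2_eq_square algebra_simps)
  have "Im (phase (Complex x y)) = 2 * y - 2 * Im (sin (Complex x y) * cos (Complex x y))
      - 2 * sqrt 2 / 3 * Re (sin (Complex x y) ^ 3)"
    by (simp add: phase_def mult.assoc)
  then show ?thesis
    unfolding sin_cos_Complex cube phase_im_def by (simp add: power2_eq_square algebra_simps)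
qed

text \<open>
  By the Cauchy-Riemann equations this is the real part of the derivative of \<open>phase\<close>; the form
  chosen here exhibits its sign on \<open>wedge\<close>.
\<close>
lemma phase_im_deriv:
  "((\<lambda>y. phase_im x y) has_real_derivative
     2 * (((sin x * cosh y)\<^sup>2 - (cos x * sinh y)\<^sup>2) * (2 - sqrt 2 * (sin x * sinh y))
       + 2 * sqrt 2 * sin x * (cos x * cosh y)\<^sup>2 * sinh y)) (at y)"
proof -
  define S C s c where "S = sin x" and "C = cos x" and "s = sinh y" and "c = cosh y"
  have 1: "C\<^sup>2 = 1 - S\<^sup>2" and 2: "c\<^sup>2 = s\<^sup>2 + 1"
    by (simp_all add: S_def C_def c_def s_def cosh_square_eq cos_squared_eq)
  have "((\<lambda>y. phase_im x y) has_real_derivative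
     2 - 2 * (C\<^sup>2 - S\<^sup>2) * (c\<^sup>2 + s\<^sup>2)
       - 2 * sqrt 2 / 3 * (3 * S ^ 3 * c\<^sup>2 * s - 3 * S * C\<^sup>2 * (s ^ 3 + 2 * c\<^sup>2 * s))) (at y)"
    unfolding phase_im_def S_def C_def s_def c_def
    by (auto intro!: derivative_eq_intros simp: algebra_simps power2_eq_square power3_eq_cube)
  also have "2 - 2 * (C\<^sup>2 - S\<^sup>2) * (c\<^sup>2 + s\<^sup>2)
       - 2 * sqrt 2 / 3 * (3 * S ^ 3 * c\<^sup>2 * s - 3 * S * C\<^sup>2 * (s ^ 3 + 2 * c\<^sup>2 * s))
     = 2 * (((S * c)\<^sup>2 - (C * s)\<^sup>2) * (2 - sqrt 2 * (S * s)) + 2 * sqrt 2 * S * (C * c)\<^sup>2 * s)"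
    unfolding power_mult_distrib 1 2 by (simp add: algebra_simps power2_eq_square power3_eq_cube)
  finally show ?thesis unfolding S_def C_def s_def c_def .
qed

lemma continuous_on_phase_im: "continuous_on A (phase_im x)"
  unfolding phase_im_def by (intro continuous_intros)

text \<open>
  Both conditions persist, in strict form, when \<open>y\<close> decreases: \<open>sinh\<close> increases, and the
  difference of the two squares is \<open>(sin x)\<^sup>2 - ((cos x)\<^sup>2 - (sin x)\<^sup>2) * (sinh y)\<^sup>2\<close>, which is
  an affine function of \<open>(sinh y)\<^sup>2\<close> with a positive value at \<open>y = 0\<close>.
\<close>
lemma wedge_below:
  assumes "wedge x y2" "0 < y1" "y1 < y2" "0 < sin x"
  shows "(cos x * sinh y1)\<^sup>2 < (sin x * cosh y1)\<^sup>2" "sin x * sinh y1 < sqrt 2"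
proof -
  have s: "0 < sinh y1" "sinh y1 < sinh y2" using assms by auto
  then show "sin x * sinh y1 < sqrt 2" using assms unfolding wedge_def
    by (smt (verit) mult_less_cancel_left)
  have e: "(sin x * cosh y)\<^sup>2 - (cos x * sinh y)\<^sup>2 = (sin x)\<^sup>2 - ((cos x)\<^sup>2 - (sin x)\<^sup>2) * (sinh y)\<^sup>2" for y
    by (simp add: power_mult_distrib cosh_square_eq algebra_simps)
  have q: "(sinh y1)\<^sup>2 < (sinh y2)\<^sup>2" using s by (intro power_strict_mono) auto
  have w: "(sin x)\<^sup>2 - ((cos x)\<^sup>2 - (sin x)\<^sup>2) * (sinh y2)\<^sup>2 \<ge> 0"
    using assms(1) e[of y2] unfolding wedge_def by linarith
  have "(sin x)\<^sup>2 > 0" using assms by simp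
  have "(sin x)\<^sup>2 - ((cos x)\<^sup>2 - (sin x)\<^sup>2) * (sinh y1)\<^sup>2 > 0"
  proof (cases "(cos x)\<^sup>2 - (sin x)\<^sup>2 > 0")
    case True
    then have "((cos x)\<^sup>2 - (sin x)\<^sup>2) * (sinh y1)\<^sup>2 < ((cos x)\<^sup>2 - (sin x)\<^sup>2) * (sinh y2)\<^sup>2"
      using q by simp
    then show ?thesis using w by linarith
  next
    case False
    then have "((cos x)\<^sup>2 - (sin x)\<^sup>2) * (sinh y1)\<^sup>2 \<le> 0" by (simp add: mult_nonpos_nonneg)
    then show ?thesis using \<open>(sin x)\<^sup>2 > 0\<close> by linarith
  qed
  then show "(cos x * sinh y1)\<^sup>2 < (sin x * cosh y1)\<^sup>2" using e[of y1] by linarith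
qed

lemma phase_im_strict_mono:
  assumes "wedge x y2" "0 \<le> y1" "y1 < y2" "0 < sin x"
  shows "phase_im x y1 < phase_im x y2"
proof (rule DERIV_pos_imp_increasing_open[OF assms(3)])
  show "continuous_on {y1..y2} (phase_im x)"
    by (rule continuous_on_phase_im)
next
  fix y assume y: "y1 < y" "y < y2"
  have w: "(cos x * sinh y)\<^sup>2 < (sin x * cosh y)\<^sup>2" "sin x * sinh y < sqrt 2"
    using wedge_below[OF assms(1) _ y(2) assms(4)] y assms by auto
  have "sqrt 2 * (sin x * sinh y) < sqrt 2 * sqrt 2" using w(2) by (intro mult_strict_left_mono) auto
  then have "0 < ((sin x * cosh y)\<^sup>2 - (cos x * sinh y)\<^sup>2) * (2 - sqrt 2 * (sin x * sinh y))"
    using w(1) by auto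
  moreover have "0 \<le> 2 * sqrt 2 * sin x * (cos x * cosh y)\<^sup>2 * sinh y"
    using assms y by simp
  ultimately have "0 < 2 * (((sin x * cosh y)\<^sup>2 - (cos x * sinh y)\<^sup>2) * (2 - sqrt 2 * (sin x * sinh y))
       + 2 * sqrt 2 * sin x * (cos x * cosh y)\<^sup>2 * sinh y)"
    by (rule mult_pos_pos[OF zero_less_numeral add_pos_nonneg])
  then show "\<exists>d. (phase_im x has_real_derivative d) (at y) \<and> 0 < d"
    using phase_im_deriv[of x y] by blast
qed

lemma sinh_le_mult_cosh: "0 \<le> (z::real) \<Longrightarrow> sinh z \<le> z * cosh z"
proof (cases "z = 0")
  case False
  assume "0 \<le> z"
  with False have "0 < z" by simp
  have "(\<lambda>z. z * cosh z - sinh z) 0 < (\<lambda>z::real. z * cosh z - sinh z) z"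
    by (rule DERIV_pos_imp_increasing_open[OF \<open>0 < z\<close>])
       (auto intro!: derivative_eq_intros continuous_intros exI conjI)
  then show ?thesis by simp
qed auto

text \<open>
  On this part of the boundary \<open>(cos x)\<^sup>2 - (sin x)\<^sup>2 = 1 / cosh (2 * y)\<close>, so the first two
  terms of \<open>phase_im\<close> add up to \<open>2 * y - tanh (2 * y) \<ge> 0\<close>, while \<open>(sin u)^3\<close> has negative real
  part because \<open>sin u\<close> lies on a ray of argument \<open>\<plusminus> pi / 4\<close>.
\<close>
lemma phase_im_pos_on_side:
  assumes "0 < sin x" "0 < y" "(cos x * sinh y)\<^sup>2 = (sin x * cosh y)\<^sup>2"
  shows "0 < phase_im x y"
proof -
  define S C s c where "S = sin x" and "C = cos x" and "s = sinh y" and "c = cosh y"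
  have 1: "C\<^sup>2 = 1 - S\<^sup>2" and 2: "c\<^sup>2 = s\<^sup>2 + 1"
    by (simp_all add: S_def C_def c_def s_def cosh_square_eq cos_squared_eq)
  have s: "s > 0" "c > 0" "S > 0" using assms by (auto simp: s_def c_def S_def)
  have eq: "C\<^sup>2 * s\<^sup>2 = S\<^sup>2 * c\<^sup>2"
    using assms(3) by (simp add: S_def C_def s_def c_def power_mult_distrib)
  then have S2: "S\<^sup>2 * (c\<^sup>2 + s\<^sup>2) = s\<^sup>2" unfolding 1 by (simp add: algebra_simps)
  have C2: "C\<^sup>2 * (c\<^sup>2 + s\<^sup>2) = c\<^sup>2" using S2 unfolding 1 2 by (simp add: algebra_simps)
  have D: "(C\<^sup>2 - S\<^sup>2) * (c\<^sup>2 + s\<^sup>2) = 1" using S2 C2 2 by (simp add: algebra_simps)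
  have pos: "c\<^sup>2 + s\<^sup>2 > 0" using s by (simp add: add_pos_pos)
  have "2 * s * c \<le> 2 * y * (c\<^sup>2 + s\<^sup>2)"
    using sinh_le_mult_cosh[of "2*y"] assms(2) by (simp add: sinh_double cosh_double s_def c_def)
  then have "(C\<^sup>2 - S\<^sup>2) * (2 * s * c) \<le> (C\<^sup>2 - S\<^sup>2) * (2 * y * (c\<^sup>2 + s\<^sup>2))"
    using D pos by (intro mult_left_mono) (smt (verit) mult_nonneg_nonneg zero_less_mult_pos2 mult_less_0_iff zero_less_mult_iff)+
  also have "\<dots> = 2 * y * ((C\<^sup>2 - S\<^sup>2) * (c\<^sup>2 + s\<^sup>2))" by (simp add: algebra_simps)
  finally have A: "2 * (C\<^sup>2 - S\<^sup>2) * s * c \<le> 2 * y" unfolding D by (simp add: algebra_simps)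
  have "(S * c) ^ 3 - 3 * (S * c) * (C * s)\<^sup>2 = - 2 * (S * c) ^ 3"
    using assms(3) unfolding S_def C_def s_def c_def by (simp add: power2_eq_square power3_eq_cube)
  moreover have "(S * c) ^ 3 > 0" using s by simp
  ultimately have "2 * sqrt 2 / 3 * ((S * c) ^ 3 - 3 * (S * c) * (C * s)\<^sup>2) < 0"
    by (simp add: mult_pos_neg)
  with A show ?thesis unfolding phase_im_def S_def C_def s_def c_def by linarith
qed

text \<open>
  With \<open>sin x * sinh y = sqrt 2\<close> and \<open>S = sin x\<close>, everything except \<open>2 * y\<close> collapses to
  \<open>sinh y * cosh y\<close> times \<open>2 - 4 / 3 * S\<^sup>2 - 2 / 3 * S^4\<close>, which is nonnegative because
  \<open>S\<^sup>2 \<le> 1\<close>.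
\<close>
lemma phase_im_pos_on_top:
  assumes "0 < sin x" "0 < y" "sin x * sinh y = sqrt 2"
  shows "0 < phase_im x y"
proof -
  define S C s c where "S = sin x" and "C = cos x" and "s = sinh y" and "c = cosh y"
  have 1: "C\<^sup>2 = 1 - S\<^sup>2" and 2: "c\<^sup>2 = s\<^sup>2 + 1"
    by (simp_all add: S_def C_def c_def s_def cosh_square_eq cos_squared_eq)
  have s: "s > 0" "c > 0" "S > 0" using assms by (auto simp: s_def c_def S_def)
  have r: "sqrt 2 = S * s" using assms by (simp add: S_def s_def)
  have Ss: "S\<^sup>2 * s\<^sup>2 = 2" using r by (metis abs_numeral power_mult_distrib real_sqrt_abs2 real_sqrt_pow2 real_sqrt_power zero_le_numeral)
  have "S\<^sup>2 \<le> 1" unfolding S_def by (metis abs_sin_le_one abs_square_le_1)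
  have "phase_im x y = 2 * y - 2 * (C\<^sup>2 - S\<^sup>2) * s * c
      - 2 * (S * s) / 3 * ((S * c) ^ 3 - 3 * (S * c) * (C * s)\<^sup>2)"
    unfolding phase_im_def S_def[symmetric] C_def[symmetric] s_def[symmetric] c_def[symmetric] r ..
  also have "\<dots> = 2 * y - 2 * (C\<^sup>2 - S\<^sup>2) * s * c
      - 2 / 3 * s * c * S\<^sup>2 * (S\<^sup>2 * c\<^sup>2) + 2 * (S\<^sup>2 * s\<^sup>2) * (s * c) * C\<^sup>2"
    by (simp add: power2_eq_square power3_eq_cube algebra_simps)
  also have "\<dots> = 2 * y + s * c * (2 - 4 / 3 * S\<^sup>2 - 2 / 3 * S\<^sup>2 * S\<^sup>2)"
  proof -
    have "S\<^sup>2 * c\<^sup>2 = 2 + S\<^sup>2" unfolding 2 using Ss by (simp add: algebra_simps)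
    then show ?thesis unfolding Ss 1 by (simp add: algebra_simps)
  qed
  also have "\<dots> > 0"
  proof -
    have "S\<^sup>2 * S\<^sup>2 \<le> 1 * 1" using \<open>S\<^sup>2 \<le> 1\<close> by (intro mult_mono) auto
    then have "0 \<le> 2 - 4 / 3 * S\<^sup>2 - 2 / 3 * (S\<^sup>2 * S\<^sup>2)" using \<open>S\<^sup>2 \<le> 1\<close> by linarith
    then have "0 \<le> s * c * (2 - 4 / 3 * S\<^sup>2 - 2 / 3 * S\<^sup>2 * S\<^sup>2)"
      using s by (intro mult_nonneg_nonneg) (auto simp: mult.assoc)
    then show ?thesis using assms by linarith
  qed
  finally show ?thesis .
qed

text \<open>
  The two conditions give \<open>(sinh y)\<^sup>2 \<le> (sin x)\<^sup>2 + 2 * (sin x * sinh y)\<^sup>2 \<le> 5\<close>.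
\<close>
lemma wedge_bound:
  assumes "wedge x y" "0 \<le> y" "0 \<le> sin x"
  shows "y \<le> 3"
proof -
  have sy: "y \<le> sinh y" using real_le_x_sinh[OF assms(2)] by (simp add: sinh_def exp_minus)
  have e: "(sin x * cosh y)\<^sup>2 - (cos x * sinh y)\<^sup>2 = (sin x)\<^sup>2 + 2 * (sin x * sinh y)\<^sup>2 - (sinh y)\<^sup>2"
    by (simp add: power_mult_distrib cosh_square_eq cos_squared_eq algebra_simps)
  have "(sin x * sinh y)\<^sup>2 \<le> (sqrt 2)\<^sup>2"
    using assms unfolding wedge_def by (intro power_mono) auto
  moreover have "(sin x)\<^sup>2 \<le> 1" by (metis abs_sin_le_one abs_square_le_1)
  ultimately have "(sinh y)\<^sup>2 \<le> 3\<^sup>2" using assms(1) e unfolding wedge_def by simp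
  then have "sinh y \<le> 3" by (rule power2_le_imp_le) simp
  with sy show ?thesis by linarith
qed

lemma phase_im_root_exists:
  assumes "0 < sin x"
  shows "\<exists>y>0. wedge x y \<and> phase_im x y = 0"
proof -
  \<comment> \<open>The region is where \<open>m \<le> 0\<close>; its boundary point above \<open>x\<close> lies below \<open>y = 4\<close> by
    \<open>wedge_bound\<close>.\<close>
  define m where "m = (\<lambda>y. max ((cos x * sinh y)\<^sup>2 - (sin x * cosh y)\<^sup>2) (sin x * sinh y - sqrt 2))"
  have wm: "wedge x y \<longleftrightarrow> m y \<le> 0" for y by (auto simp: wedge_def m_def)
  have cm: "continuous_on A m" for A unfolding m_def by (intro continuous_intros)
  have "m 0 \<le> 0" using assms by (simp add: m_def)
  moreover have "0 \<le> m 4" using wedge_bound[of x 4] wm[of 4] assms by linarith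
  ultimately obtain Y where Y: "0 \<le> Y" "Y \<le> 4" "m Y = 0"
    using IVT'[of m 0 0 4] cm by auto
  have "Y \<noteq> 0"
  proof
    assume "Y = 0"
    then have "m Y < 0" using assms by (simp add: m_def)
    then show False using Y by simp
  qed
  then have "0 < Y" using Y by simp
  have wY: "wedge x Y" using Y wm by simp
  have "(cos x * sinh Y)\<^sup>2 = (sin x * cosh Y)\<^sup>2 \<or> sin x * sinh Y = sqrt 2"
    using Y(3) by (auto simp: m_def max_def split: if_splits)
  then have p: "0 < phase_im x Y"
    using phase_im_pos_on_side phase_im_pos_on_top assms \<open>0 < Y\<close> by blast
  have n: "phase_im x 0 < 0" using assms by (simp add: phase_im_def)
  have "continuous_on {0..Y} (phase_im x)"
    by (rule continuous_on_phase_im)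
  then obtain y where y: "0 \<le> y" "y \<le> Y" "phase_im x y = 0"
    using IVT'[of "phase_im x" 0 0 Y] n p \<open>0 < Y\<close> by auto
  have "y \<noteq> 0" "y \<noteq> Y" using n p y(3) by auto
  then have "0 < y" "y < Y" using y by auto
  then have "wedge x y" using wedge_below[OF wY _ _ assms, of y] by (auto simp: wedge_def)
  with \<open>0 < y\<close> y show ?thesis by blast
qed

text \<open>
  A zero of \<open>phase_im\<close> can lie on no part of the boundary of the region, so it can be perturbed
  in all directions inside it.
\<close>
lemma phase_im_root_strict:
  assumes "0 < sin x" "0 \<le> y" "wedge x y" "phase_im x y = 0"
  shows "0 < y" "(cos x * sinh y)\<^sup>2 < (sin x * cosh y)\<^sup>2" "sin x * sinh y < sqrt 2"
proof -
  have "phase_im x 0 < 0" using assms by (simp add: phase_im_def)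
  then have "y \<noteq> 0" using assms by auto
  then show y: "0 < y" using assms by auto
  show "(cos x * sinh y)\<^sup>2 < (sin x * cosh y)\<^sup>2"
    using phase_im_pos_on_side[OF assms(1) y] assms(3,4) unfolding wedge_def by linarith
  show "sin x * sinh y < sqrt 2"
    using phase_im_pos_on_top[OF assms(1) y] assms(3,4) unfolding wedge_def by linarith
qed

section \<open>The entire function that uniformizes the phase\<close>

text \<open>
  The quotient function is \<open>e \<circ> Arccos\<close>. It is continuous because \<open>cos\<close> is an open surjection,
  it is holomorphic away from the critical values \<open>\<plusminus> 1\<close> because \<open>cos\<close> has local holomorphic
  inverses there, and the remaining two singularities are removable.
\<close>
lemma holomorphic_descends_along_cos:
  assumes e: "e holomorphic_on UNIV" and eq: "\<And>a b. cos a = cos b \<Longrightarrow> e a = e b"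
  shows "\<exists>H. H holomorphic_on UNIV \<and> (\<forall>u. H (cos u) = e u)"
proof -
  define H where "H = (\<lambda>c. e (Arccos c))"
  have Hcos: "H (cos u) = e u" for u unfolding H_def by (rule eq) simp
  have opn: "open (cos ` U)" if "open U" for U :: "complex set"
  proof (rule open_mapping_thm[of cos UNIV])
    have "cos (0::complex) \<noteq> cos (of_real pi)" by (simp add: cos_of_real)
    then show "\<not> (cos :: complex \<Rightarrow> complex) constant_on UNIV" by (metis UNIV_I constant_on_def)
  qed (use that in \<open>auto intro!: holomorphic_intros\<close>)
  have ce: "continuous_on UNIV e" using e by (rule holomorphic_on_imp_continuous_on)
  have "H -` V = cos ` (e -` V)" for V
  proof (intro set_eqI iffI)
    fix c assume "c \<in> H -` V"
    then have "Arccos c \<in> e -` V" "c = cos (Arccos c)" by (auto simp: H_def)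
    then show "c \<in> cos ` (e -` V)" by blast
  qed (auto simp: Hcos)
  then have cont: "continuous_on UNIV H"
    using ce by (simp add: continuous_on_open_vimage opn)
  have "H holomorphic_on UNIV"
  proof (rule no_isolated_singularity[OF cont])
    show "H holomorphic_on (UNIV - {1, -1})"
      unfolding holomorphic_on_def
    proof
      fix w :: complex assume w: "w \<in> UNIV - {1, -1}"
      define u where "u = Arccos w"
      have cu: "cos u = w" by (simp add: u_def)
      have "(sin u)\<^sup>2 = 1 - w\<^sup>2" using sin_squared_eq[of u] cu by simp
      then have "sin u \<noteq> 0" using w by (auto simp: power2_eq_1_iff)
      moreover have "deriv cos u = - sin u" by (intro DERIV_imp_deriv DERIV_cos)
      ultimately have "deriv cos u \<noteq> 0" by simp
      then obtain r where r: "r > 0" "open (cos ` ball u r)" "inj_on cos (ball u r)"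
        using has_complex_derivative_locally_invertible[OF holomorphic_on_cos, of u UNIV]
        by auto
      then obtain g where g: "g holomorphic_on (cos ` ball u r)" "\<And>z. z \<in> ball u r \<Longrightarrow> g (cos z) = z"
        using holomorphic_has_inverse[OF holomorphic_on_cos open_ball r(3)] by metis
      have "(\<lambda>c. e (g c)) holomorphic_on cos ` ball u r"
        using holomorphic_on_compose[OF g(1) holomorphic_on_subset[OF e]] by (simp add: o_def)
      then have "H holomorphic_on cos ` ball u r"
        by (rule holomorphic_transform) (auto simp: Hcos g(2))
      moreover have "w \<in> cos ` ball u r" using cu r(1) by force
      ultimately have "H field_differentiable at w"
        using r(2) holomorphic_on_imp_differentiable_at by blast
      then show "H field_differentiable at w within UNIV - {1, -1}"
        by (rule field_differentiable_at_within)
    qed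
  qed auto
  with Hcos show ?thesis by blast
qed

lemma phase_deriv: "(phase has_field_derivative 2 * (sin u)\<^sup>2 * (2 - of_real (sqrt 2) * \<i> * cos u)) (at u)"
proof -
  have "(phase has_field_derivative 2 - 2 * (cos u * cos u - sin u * sin u)
     - of_real (2 * sqrt 2 / 3) * \<i> * (3 * (sin u)\<^sup>2 * cos u)) (at u)"
    unfolding phase_def by (auto intro!: derivative_eq_intros simp: algebra_simps)
  also have "2 - 2 * (cos u * cos u - sin u * sin u)
     - of_real (2 * sqrt 2 / 3) * \<i> * (3 * (sin u)\<^sup>2 * cos u)
     = 2 * (sin u)\<^sup>2 * (2 - of_real (sqrt 2) * \<i> * cos u)"
  proof -
    have "2 - 2 * (cos u * cos u - sin u * sin u) = 4 * (sin u)\<^sup>2"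
      using sin_cos_squared_add[of u] unfolding power2_eq_square by algebra
    then show ?thesis by (simp add: algebra_simps)
  qed
  finally show ?thesis .
qed

text \<open>
  Two preimages under \<open>cos\<close> differ by a sign and a period \<open>2 * k * pi\<close>. As \<open>phase\<close> is odd and
  grows by \<open>4 * k * pi\<close> along the period, the quarter of it changes by a sign and by \<open>k * pi\<close>,
  to which \<open>cos\<^sup>2\<close> is blind.
\<close>
lemma cos_phase_quarter_cong:
  assumes "cos a = cos b"
  shows "(cos (phase a / 4))\<^sup>2 = (cos (phase b / 4))\<^sup>2"
proof -
  obtain n where n: "n \<in> \<int>" "a = b + of_real (2*n*pi) \<or> a = - b + of_real (2*n*pi)"
    using assms complex_cos_eq by blast
  then obtain k :: int where k: "n = of_int k" by (auto elim: Ints_cases)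
  have sc: "sin (z + of_real (2 * of_int k * pi)) = sin z" "cos (z + of_real (2 * of_int k * pi)) = cos z" for z :: complex
    using sin.plus_of_int[of z k] cos.plus_of_int[of z k] by (simp_all add: mult_ac)
  have ph: "phase (z + of_real (2 * of_int k * pi)) = phase z + 4 * of_real (of_int k * pi)" for z
    unfolding phase_def sc by (simp add: algebra_simps)
  have sq: "(cos (z + of_real (of_int k * pi)))\<^sup>2 = (cos z)\<^sup>2" for z :: complex
  proof -
    have "cos (2 * (z + of_real (of_int k * pi))) = cos (2 * z)"
      using sc(2)[of "2 * z"] by (simp add: algebra_simps)
    then show ?thesis unfolding cos_double_cos by simp
  qed
  have od: "phase (- z) = - phase z" for z by (simp add: phase_def)
  show ?thesis using n(2)
  proof
    assume "a = b + of_real (2*n*pi)"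
    then have a: "a = b + of_real (2 * of_int k * pi)" using k by simp
    have "phase a / 4 = phase b / 4 + of_real (of_int k * pi)"
      unfolding a ph by (simp only: add_divide_distrib) simp
    then show ?thesis by (simp only: sq)
  next
    assume "a = - b + of_real (2*n*pi)"
    then have a: "a = - b + of_real (2 * of_int k * pi)" using k by simp
    have "phase a / 4 = - (phase b / 4) + of_real (of_int k * pi)"
      unfolding a ph od by (simp only: add_divide_distrib) simp
    then show ?thesis by (simp only: sq cos_minus)
  qed
qed

text \<open>
  The differential equation expresses that \<open>h = cos\<^sup>2 (s / 4)\<close> satisfies
  \<open>4 * (dh / ds)\<^sup>2 = h * (1 - h)\<close>, with \<open>s = phase u\<close> and
  \<open>ds = - 2 * sin u * (2 - sqrt 2 * \<i> * cos u) dc\<close> for \<open>c = cos u\<close>.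
\<close>
lemma uniformizing_function:
  "\<exists>H. H holomorphic_on UNIV \<and> (\<forall>u. H (cos u) = (cos (phase u / 4))\<^sup>2) \<and>
     (\<forall>c. (deriv H c)\<^sup>2 = H c * (1 - H c) * (1 - c\<^sup>2) * (2 - of_real (sqrt 2) * \<i> * c)\<^sup>2)"
proof -
  have "(\<lambda>u. (cos (phase u / 4))\<^sup>2) holomorphic_on UNIV"
    unfolding phase_def by (intro holomorphic_intros) auto
  then obtain H where H: "H holomorphic_on UNIV" "\<forall>u. H (cos u) = (cos (phase u / 4))\<^sup>2"
    using holomorphic_descends_along_cos[of "\<lambda>u. (cos (phase u / 4))\<^sup>2"] cos_phase_quarter_cong by blast
  have dH: "(H has_field_derivative deriv H c) (at c)" for c
    by (rule holomorphic_derivI[OF H(1) open_UNIV UNIV_I])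
  \<comment> \<open>Away from \<open>\<plusminus> 1\<close> the equation follows by the chain rule, since \<open>sin u\<close> can be cancelled; at
    \<open>\<plusminus> 1\<close> it holds by the identity theorem.\<close>
  define E where "E = (\<lambda>c. H c * (1 - H c) * (1 - c\<^sup>2) * (2 - of_real (sqrt 2) * \<i> * c)\<^sup>2)"
  have "(deriv H c)\<^sup>2 = E c" if "c \<in> - {1, -1}" for c
  proof -
    obtain u where u: "cos u = c" by (metis cos_Arccos)
    have s2: "(sin u)\<^sup>2 = 1 - c\<^sup>2" using sin_squared_eq[of u] u by simp
    then have "sin u \<noteq> 0" using that by (auto simp: power2_eq_1_iff)
    have dc: "((\<lambda>u. cos (phase u / 4)) has_field_derivative
       - sin (phase u / 4) * (2 * (sin u)\<^sup>2 * (2 - of_real (sqrt 2) * \<i> * cos u) / 4)) (at u)"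
      by (rule DERIV_chain2[OF DERIV_cos DERIV_cdivide[OF phase_deriv]])
    have "((\<lambda>u. (cos (phase u / 4))\<^sup>2) has_field_derivative
       - (cos (phase u / 4) * sin (phase u / 4) * (sin u)\<^sup>2 * (2 - of_real (sqrt 2) * \<i> * cos u))) (at u)"
      using DERIV_power[OF dc, of 2] by (rule DERIV_cong) (simp add: field_simps)
    moreover have "((\<lambda>u. H (cos u)) has_field_derivative deriv H (cos u) * - sin u) (at u)"
      by (rule DERIV_chain2[OF dH DERIV_cos])
    then have "((\<lambda>u. (cos (phase u / 4))\<^sup>2) has_field_derivative deriv H (cos u) * - sin u) (at u)"
      using H(2) by simp
    ultimately have "- (cos (phase u / 4) * sin (phase u / 4) * (sin u)\<^sup>2 * (2 - of_real (sqrt 2) * \<i> * c))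
       = deriv H c * - sin u"
      unfolding u by (rule DERIV_unique)
    then have "sin u * deriv H c = sin u * (cos (phase u / 4) * sin (phase u / 4) * sin u * (2 - of_real (sqrt 2) * \<i> * c))"
      by (auto simp add: power2_eq_square mult_ac)
    then have d: "deriv H c = cos (phase u / 4) * sin (phase u / 4) * sin u * (2 - of_real (sqrt 2) * \<i> * c)"
      using \<open>sin u \<noteq> 0\<close> using mult_left_cancel by blast
    have h1: "H c = (cos (phase u / 4))\<^sup>2" using H(2) u by metis
    then have h2: "1 - H c = (sin (phase u / 4))\<^sup>2" by (simp only: sin_squared_eq)
    show ?thesis unfolding d E_def power_mult_distrib s2 h2 by (simp only: h1)
  qed
  note off_branch = this
  have "(deriv H c)\<^sup>2 = E c" for c
  proof (rule analytic_continuation_open[of "- {1, -1}" UNIV "\<lambda>c. (deriv H c)\<^sup>2" E c])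
    show "open (- {1, -1 :: complex})" by (intro open_Compl finite_imp_closed) simp
    have "0 \<in> - {1, -1 :: complex}" by simp
    then show "- {1, -1 :: complex} \<noteq> {}" by blast
    show "(\<lambda>c. (deriv H c)\<^sup>2) holomorphic_on UNIV" "E holomorphic_on UNIV"
      unfolding E_def by (intro holomorphic_intros H(1) holomorphic_deriv open_UNIV)+
  qed (simp_all add: off_branch connected_UNIV)
  with H show ?thesis unfolding E_def by blast
qed

section \<open>The curve on which the phase is real\<close>

text \<open>
  If \<open>f\<close> took the same value at two points, then on the interval between them a maximum or a
  minimum would be attained in the interior, or \<open>f\<close> would be constant there.
\<close>
lemma inj_on_if_no_local_extremum:
  fixes f :: "real \<Rightarrow> real"
  assumes cont: "continuous_on {a..b} f"
    and ext: "\<And>x p y. \<lbrakk>a \<le> x; x < p; p < y; y \<le> b\<rbrakk>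
       \<Longrightarrow> (\<exists>q\<in>{x<..<y}. f q < f p) \<and> (\<exists>q\<in>{x<..<y}. f p < f q)"
  shows "inj_on f {a..b}"
proof (rule linorder_inj_onI')
  fix x y assume xy: "x \<in> {a..b}" "y \<in> {a..b}" "x < y"
  have c: "continuous_on {x..y} f" using cont by (rule continuous_on_subset) (use xy in auto)
  have "{x..y} \<noteq> {}" using xy by simp
  then obtain p where p: "p \<in> {x..y}" "\<forall>q\<in>{x..y}. f q \<le> f p"
    using continuous_attains_sup[OF compact_Icc _ c] by blast
  from \<open>{x..y} \<noteq> {}\<close> obtain m where m: "m \<in> {x..y}" "\<forall>q\<in>{x..y}. f m \<le> f q"
    using continuous_attains_inf[OF compact_Icc _ c] by blast
  have inner: "(\<exists>q\<in>{x<..<y}. f q < f r) \<and> (\<exists>q\<in>{x<..<y}. f r < f q)" if "x < r" "r < y" for r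
    using ext[of x r y] that xy by auto
  show "f x \<noteq> f y"
  proof
    assume eq: "f x = f y"
    have "\<not> (x < p \<and> p < y)"
    proof
      assume "x < p \<and> p < y"
      then obtain q where "q \<in> {x<..<y}" "f p < f q" using inner[of p] by blast
      then show False using bspec[OF p(2), of q] by auto
    qed
    then have "p = x \<or> p = y" using p(1) by auto
    have "\<not> (x < m \<and> m < y)"
    proof
      assume "x < m \<and> m < y"
      then obtain q where "q \<in> {x<..<y}" "f q < f m" using inner[of m] by blast
      then show False using bspec[OF m(2), of q] by auto
    qed
    then have "m = x \<or> m = y" using m(1) by auto
    with \<open>p = x \<or> p = y\<close> have "f p = f m" using eq by auto
    obtain q where "q \<in> {x<..<y}" "f q < f ((x + y) / 2)"
      using inner[of "(x + y) / 2"] xy by auto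
    moreover from this have "f m \<le> f q" "f ((x + y) / 2) \<le> f p"
      using bspec[OF m(2), of q] bspec[OF p(2), of "(x + y) / 2"] by auto
    ultimately show False using \<open>f p = f m\<close> by linarith
  qed
qed

lemma Im_phase_Re_Im: "Im (phase u) = phase_im (Re u) (Im u)"
  using Im_phase[of "Re u" "Im u"] by simp

definition level_set :: "complex set" where
  "level_set = {u. 0 \<le> Re u \<and> Re u \<le> pi \<and> 0 \<le> Im u \<and> wedge (Re u) (Im u) \<and> Im (phase u) = 0}"

lemma compact_level_set: "compact level_set"
proof -
  have "closed level_set"
    unfolding level_set_def wedge_def phase_def
    by (intro closed_Collect_conj closed_Collect_le closed_Collect_eq continuous_intros)
  moreover have "cmod u \<le> pi + 3" if "u \<in> level_set" for u
  proof -
    have "0 \<le> sin (Re u)" using that by (intro sin_ge_zero) (auto simp: level_set_def)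
    then have "Im u \<le> 3" using that wedge_bound by (auto simp: level_set_def)
    then show ?thesis using cmod_le[of u] that by (auto simp: level_set_def)
  qed
  then have "bounded level_set" by (auto intro: boundedI)
  ultimately show ?thesis by (simp add: compact_eq_bounded_closed)
qed

lemma level_set_ends:
  "0 \<in> level_set" "of_real pi \<in> level_set"
  "u \<in> level_set \<Longrightarrow> Re u = 0 \<Longrightarrow> u = 0"
  "u \<in> level_set \<Longrightarrow> Re u = pi \<Longrightarrow> u = of_real pi"
proof -
  show "0 \<in> level_set" "of_real pi \<in> level_set"
    by (simp_all add: level_set_def wedge_def Im_phase_Re_Im phase_im_def)
  show "u = 0" if "u \<in> level_set" "Re u = 0"
    using that by (simp add: level_set_def wedge_def complex_eq_iff)
  show "u = of_real pi" if "u \<in> level_set" "Re u = pi"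
    using that by (simp add: level_set_def wedge_def complex_eq_iff)
qed

lemma level_set_interior:
  assumes "u \<in> level_set" "0 < Re u" "Re u < pi"
  shows "0 < Im u" "(cos (Re u) * sinh (Im u))\<^sup>2 < (sin (Re u) * cosh (Im u))\<^sup>2"
    "sin (Re u) * sinh (Im u) < sqrt 2"
  using phase_im_root_strict[of "Re u" "Im u"] assms sin_gt_zero[of "Re u"]
  by (auto simp: level_set_def Im_phase_Re_Im)

text \<open>
  Strict monotonicity of \<open>phase_im\<close> in \<open>y\<close> leaves at most one point on each inner vertical line,
  and on the two outer lines, where \<open>sin x = 0\<close>, the wedge shrinks to the point \<open>y = 0\<close>.
\<close>
lemma inj_on_Re_level_set: "inj_on Re level_set"
proof (rule inj_onI)
  fix u v assume uv: "u \<in> level_set" "v \<in> level_set" "Re u = Re v"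
  consider "Re u = 0" | "Re u = pi" | "0 < Re u" "Re u < pi"
    using uv by (force simp: level_set_def)
  then show "u = v"
  proof cases
    case 3
    have nl: "\<not> a < b" if "{Complex (Re u) a, Complex (Re u) b} \<subseteq> level_set" for a b
      using phase_im_strict_mono[of "Re u" b a] that sin_gt_zero[OF 3]
      by (auto simp: level_set_def Im_phase_Re_Im)
    have "Complex (Re u) (Im v) = v" using uv by (simp add: complex_eq_iff)
    moreover have "Complex (Re u) (Im u) = u" by simp
    ultimately have "\<not> Im u < Im v" "\<not> Im v < Im u"
      using nl[of "Im u" "Im v"] nl[of "Im v" "Im u"] uv(1,2) by (simp_all only: insert_subset empty_subsetI simp_thms)
    then show ?thesis using uv by (simp add: complex_eq_iff)
  qed (use uv level_set_ends in metis)+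
qed

lemma Re_level_set: "Re ` level_set = {0..pi}"
proof
  show "Re ` level_set \<subseteq> {0..pi}" by (auto simp: level_set_def)
  show "{0..pi} \<subseteq> Re ` level_set"
  proof
    fix x assume x: "x \<in> {0..pi}"
    consider "x = 0" | "x = pi" | "0 < x" "x < pi" using x by force
    then show "x \<in> Re ` level_set"
    proof cases
      case 3
      then obtain y where "y > 0" "wedge x y" "phase_im x y = 0"
        using phase_im_root_exists sin_gt_zero by blast
      then have "Complex x y \<in> level_set" using 3 by (simp add: level_set_def Im_phase)
      then show ?thesis by force
    qed (use level_set_ends in force)+
  qed
qed

text \<open>
  The level set is compact and mapped bijectively onto \<open>[0, pi]\<close> by \<open>Re\<close>, so it is the graph of
  a continuous function of \<open>Re u\<close>. It is then reparametrized by the value of \<open>phase\<close>, which is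
  possible once this value is known to be injective along the graph. The last conjunct keeps the
  curve above the double zero of \<open>Q\<close>.
\<close>
lemma level_curve:
  "\<exists>U. continuous_on {0..2 * pi} U \<and> U 0 = 0 \<and> U (2 * pi) = of_real pi \<and>
     (\<forall>s\<in>{0..2 * pi}. phase (U s) = of_real s) \<and>
     (\<forall>s\<in>{0<..<2 * pi}. - sqrt 2 < Im (cos (U s)))"
proof -
  define v where "v = inv_into level_set Re"
  have v: "v x \<in> level_set" "Re (v x) = x" if "x \<in> {0..pi}" for x
    using that Re_level_set unfolding v_def by (metis inv_into_into, metis f_inv_into_f)
  have vRe: "v (Re u) = u" if "u \<in> level_set" for u
    unfolding v_def using inj_on_Re_level_set that by (rule inv_into_f_f)
  have "continuous_on (Re ` level_set) v"
    by (rule continuous_on_inv[OF _ compact_level_set]) (auto intro: continuous_intros simp: vRe)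
  then have cv: "continuous_on {0..pi} v" by (simp add: Re_level_set)
  have hol: "phase holomorphic_on A" for A
    unfolding phase_def by (intro holomorphic_intros)
  define s where "s = (\<lambda>x. Re (phase (v x)))"
  have ps: "phase (v x) = of_real (s x)" if "x \<in> {0..pi}" for x
    using v(1)[OF that] by (simp add: complex_eq_iff s_def level_set_def)
  have cs: "continuous_on {0..pi} s"
    unfolding s_def
    by (intro continuous_on_Re continuous_on_compose2[OF holomorphic_on_imp_continuous_on[OF hol] cv subset_UNIV])
  have v0: "v 0 = 0" and vpi: "v pi = of_real pi" using vRe level_set_ends by (metis zero_complex.sel(1), metis Re_complex_of_real)
  have s0: "s 0 = 0" "s pi = 2 * pi" by (simp_all add: s_def v0 vpi phase_def)
  have "inj_on s {0..pi}"
  proof (rule inj_on_if_no_local_extremum[OF cs])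
    fix x p y assume xy: "0 \<le> x" "x < p" "p < y" "y \<le> pi"
    \<comment> \<open>All points of the open set \<open>N\<close> at which \<open>phase\<close> is real lie on the level set over
      \<open>(x, y)\<close>; openness of the image of \<open>N\<close> supplies values of \<open>phase\<close> on both sides of the one
      at \<open>p\<close>.\<close>
    define N where "N = {u. x < Re u \<and> Re u < y \<and> 0 < Im u \<and>
       (cos (Re u) * sinh (Im u))\<^sup>2 < (sin (Re u) * cosh (Im u))\<^sup>2 \<and> sin (Re u) * sinh (Im u) < sqrt 2}"
    have "open N" unfolding N_def
      by (intro open_Collect_conj open_Collect_less continuous_intros)
    have "phase 0 \<noteq> phase (of_real pi)" by (simp add: phase_def)
    then have "\<not> phase constant_on UNIV" by (metis UNIV_I constant_on_def)
    then have "open (phase ` N)"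
      using open_mapping_thm[OF hol open_UNIV connected_UNIV \<open>open N\<close>] by simp
    moreover have "v p \<in> N"
      using level_set_interior[of "v p"] v[of p] xy by (auto simp: N_def)
    then have "of_real (s p) \<in> phase ` N" using ps[of p] xy by force
    ultimately obtain e where e: "e > 0" "cball (of_real (s p)) e \<subseteq> phase ` N"
      by (meson open_contains_cball)
    have reach: "\<exists>q\<in>{x<..<y}. s q = s p + d" if "\<bar>d\<bar> \<le> e" for d
    proof -
      have "of_real (s p + d) \<in> cball (complex_of_real (s p)) e"
        using that by (simp add: dist_norm)
      then obtain u where u: "u \<in> N" "phase u = of_real (s p + d)" using e by (metis imageE subsetD)
      then have "u \<in> level_set" using xy by (auto simp: N_def level_set_def wedge_def)
      then have "s (Re u) = s p + d" using vRe[of u] u(2) by (simp add: s_def)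
      then show ?thesis using u(1) by (auto simp: N_def)
    qed
    show "(\<exists>q\<in>{x<..<y}. s q < s p) \<and> (\<exists>q\<in>{x<..<y}. s p < s q)"
      using reach[of e] reach[of "- e"] e(1) by force
  qed
  note inj = this
  have "s ` {0..pi} = {0..2 * pi}"
  proof
    show "s ` {0..pi} \<subseteq> {0..2 * pi}"
    proof
      fix r assume "r \<in> s ` {0..pi}"
      then obtain x where x: "x \<in> {0..pi}" "r = s x" by blast
      consider "x = 0" | "x = pi" | "0 < x" "x < pi" using x by force
      then show "r \<in> {0..2 * pi}"
        using continuous_inj_imp_mono[OF _ _ cs inj, of x] s0 x(2) by cases auto
    qed
    show "{0..2 * pi} \<subseteq> s ` {0..pi}"
    proof
      fix r assume "r \<in> {0..2 * pi}"
      then show "r \<in> s ` {0..pi}" using IVT'[of s 0 r pi] cs s0 by auto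
    qed
  qed
  note im = this
  define X where "X = inv_into {0..pi} s"
  have X: "X r \<in> {0..pi}" "s (X r) = r" if "r \<in> {0..2 * pi}" for r
    using that im unfolding X_def by (metis inv_into_into, metis f_inv_into_f)
  have Xs: "X (s x) = x" if "x \<in> {0..pi}" for x
    unfolding X_def using inj that by (rule inv_into_f_f)
  have cX: "continuous_on {0..2 * pi} X"
    using continuous_on_inv[OF cs compact_Icc, of X] Xs im by simp
  define U where "U = (\<lambda>r. v (X r))"
  have "continuous_on {0..2 * pi} U"
    unfolding U_def by (rule continuous_on_compose2[OF cv cX]) (use X in blast)
  moreover have "U 0 = 0" "U (2 * pi) = of_real pi"
    using Xs[of 0] Xs[of pi] s0 v0 vpi by (simp_all add: U_def)
  moreover have "phase (U r) = of_real r" if "r \<in> {0..2 * pi}" for r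
    using ps X[OF that] by (simp add: U_def)
  moreover have "- sqrt 2 < Im (cos (U r))" if r: "r \<in> {0<..<2 * pi}" for r
  proof -
    have "X r \<in> {0..pi}" "s (X r) = r" using X r by auto
    moreover from this have "X r \<noteq> 0" "X r \<noteq> pi" using s0 r by auto
    ultimately have "sin (Re (U r)) * sinh (Im (U r)) < sqrt 2"
      using level_set_interior(3)[of "U r"] v[of "X r"] by (auto simp: U_def)
    moreover have "Im (cos (U r)) = - (sin (Re (U r)) * sinh (Im (U r)))"
      using sin_cos_Complex(2)[of "Re (U r)" "Im (U r)"] by simp
    ultimately show ?thesis by linarith
  qed
  ultimately show ?thesis by blast
qed

section \<open>Analytic arcs from ramified equations\<close>

text \<open>
  This says that \<open>F\<close> takes its value at \<open>c\<close> with multiplicity exactly \<open>n\<close>, in the form of the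
  local normal form \<open>F = F c + \<zeta>^n\<close> with a local coordinate \<open>\<zeta>\<close> at \<open>c\<close>.
\<close>
definition has_nth_root_at :: "(complex \<Rightarrow> complex) \<Rightarrow> complex \<Rightarrow> nat \<Rightarrow> bool" where
  "has_nth_root_at F c n \<longleftrightarrow> (\<exists>r>0. \<exists>\<zeta>. \<zeta> holomorphic_on ball c r \<and> \<zeta> c = 0 \<and> deriv \<zeta> c \<noteq> 0 \<and>
     (\<forall>z\<in>ball c r. F z - F c = \<zeta> z ^ n))"

lemma has_nth_root_at_1:
  assumes "F holomorphic_on UNIV" "deriv F c \<noteq> 0"
  shows "has_nth_root_at F c 1"
proof -
  have "((\<lambda>z. F z - F c) has_field_derivative deriv F c - 0) (at c)"
    by (intro DERIV_diff DERIV_const holomorphic_derivI[OF assms(1) open_UNIV UNIV_I])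
  then have "deriv (\<lambda>z. F z - F c) c \<noteq> 0" using assms(2) DERIV_imp_deriv by fastforce
  moreover have "(\<lambda>z. F z - F c) holomorphic_on ball c 1"
    by (intro holomorphic_intros holomorphic_on_subset[OF assms(1)]) simp
  ultimately show ?thesis unfolding has_nth_root_at_def
    by (intro exI[of _ 1] conjI exI[of _ "\<lambda>z. F z - F c"]) simp_all
qed

lemma has_nth_root_atI:
  assumes r0: "r0 > 0" and h0: "h holomorphic_on ball c r0" "h c \<noteq> 0" and "n > 0"
    and fac: "\<And>z. z \<in> ball c r0 \<Longrightarrow> F z - F c = (z - c) ^ n * h z"
  shows "has_nth_root_at F c n"
proof -
  have "isCont h c"
    using holomorphic_on_imp_continuous_on[OF h0(1)] r0
    by (simp add: continuous_on_eq_continuous_at)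
  then obtain e where e: "e > 0" "\<forall>z. dist c z < e \<longrightarrow> h z \<noteq> 0"
    using continuous_at_avoid[of c h 0] h0(2) by blast
  define r where "r = min r0 e"
  have r: "r > 0" using r0 e(1) by (simp add: r_def)
  have h: "h holomorphic_on ball c r" "\<And>z. z \<in> ball c r \<Longrightarrow> h z \<noteq> 0"
    and facr: "\<And>z. z \<in> ball c r \<Longrightarrow> F z - F c = (z - c) ^ n * h z"
    using e(2) fac h0(1) by (auto simp: r_def elim: holomorphic_on_subset)
  obtain g where g: "g holomorphic_on ball c r" "\<And>z. z \<in> ball c r \<Longrightarrow> exp (g z) = h z"
    using holomorphic_logarithm_exists[of "ball c r" h c] h r by auto
  define \<zeta> where "\<zeta> = (\<lambda>z. (z - c) * exp (g z / of_nat n))"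
  have hol: "(\<lambda>z. exp (g z / of_nat n)) holomorphic_on ball c r"
    using \<open>n > 0\<close> by (intro holomorphic_intros g(1)) simp
  then have 1: "\<zeta> holomorphic_on ball c r" unfolding \<zeta>_def by (intro holomorphic_on_mult hol) (intro holomorphic_intros)
  have "((\<lambda>z. exp (g z / of_nat n)) has_field_derivative deriv (\<lambda>z. exp (g z / of_nat n)) c) (at c)"
    using hol r by (intro holomorphic_derivI[OF _ open_ball]) auto
  from DERIV_mult[OF DERIV_diff[OF DERIV_ident DERIV_const[of c]] this]
  have "(\<zeta> has_field_derivative exp (g c / of_nat n)) (at c)"
    by (simp add: \<zeta>_def)
  then have 2: "deriv \<zeta> c \<noteq> 0" using DERIV_imp_deriv by fastforce
  have pw: "exp (g z / of_nat n) ^ n = h z" if "z \<in> ball c r" for z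
    using g(2)[OF that] \<open>n > 0\<close> by (simp flip: exp_of_nat_mult)
  have "F z - F c = \<zeta> z ^ n" if "z \<in> ball c r" for z
    unfolding facr[OF that] \<zeta>_def power_mult_distrib pw[OF that] ..
  with 1 2 r show ?thesis unfolding has_nth_root_at_def
    by (intro exI[of _ r] conjI exI[of _ \<zeta>]) (auto simp: \<zeta>_def)
qed

text \<open>
  Let \<open>\<zeta>\<close> and \<open>\<eta>\<close> be the \<open>n\<close>-th roots of \<open>F - F (\<gamma> t0)\<close> and \<open>q - q t0\<close>. Then \<open>\<zeta> (\<gamma> t) / \<eta> t\<close> is
  an \<open>n\<close>-th root of unity for \<open>t \<noteq> t0\<close>. It is constant, by continuity if these \<open>t\<close> form an
  interval, and trivially if \<open>n = 1\<close>. Hence \<open>\<gamma> = \<zeta>\<^sup>-\<^sup>1 \<circ> (a * \<eta>)\<close> near \<open>t0\<close> with a constant \<open>a\<close>.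
  The condition on \<open>T\<close> is what restricts ramified lifting to end points: on two sides of \<open>t0\<close>
  different roots of unity could occur.
\<close>
lemma local_lift:
  fixes \<gamma> :: "real \<Rightarrow> complex"
  assumes F: "has_nth_root_at F (\<gamma> t0) n" and q: "has_nth_root_at q (of_real t0) n"
    and "n > 0" "t0 \<in> T" "continuous_on T \<gamma>"
    and eq: "\<And>t. t \<in> T \<Longrightarrow> F (\<gamma> t) = q (of_real t)"
    and T: "n = 1 \<or> is_interval (T - {t0})"
  shows "\<exists>r>0. \<exists>f. f holomorphic_on ball (of_real t0) r \<and> deriv f (of_real t0) \<noteq> 0 \<and>
     (\<forall>t\<in>T. \<bar>t - t0\<bar> < r \<longrightarrow> \<gamma> t = f (of_real t))"
proof -
  define c0 and \<tau> :: complex where "c0 = \<gamma> t0" and "\<tau> = of_real t0"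
  obtain r1 \<zeta> where \<zeta>: "r1 > 0" "\<zeta> holomorphic_on ball c0 r1" "\<zeta> c0 = 0" "deriv \<zeta> c0 \<noteq> 0"
    "\<And>z. z \<in> ball c0 r1 \<Longrightarrow> F z - F c0 = \<zeta> z ^ n"
    using F unfolding has_nth_root_at_def c0_def by blast
  obtain r2 \<eta> where \<eta>: "r2 > 0" "\<eta> holomorphic_on ball \<tau> r2" "\<eta> \<tau> = 0" "deriv \<eta> \<tau> \<noteq> 0"
    "\<And>z. z \<in> ball \<tau> r2 \<Longrightarrow> q z - q \<tau> = \<eta> z ^ n"
    using q unfolding has_nth_root_at_def \<tau>_def by blast
  obtain \<rho>1 where \<rho>1: "\<rho>1 > 0" "ball c0 \<rho>1 \<subseteq> ball c0 r1" "open (\<zeta> ` ball c0 \<rho>1)" "inj_on \<zeta> (ball c0 \<rho>1)"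
    by (rule has_complex_derivative_locally_invertible[OF \<zeta>(2) _ open_ball \<zeta>(4)]) (use \<zeta>(1) in auto)
  obtain \<rho>2 where \<rho>2: "\<rho>2 > 0" "ball \<tau> \<rho>2 \<subseteq> ball \<tau> r2" "inj_on \<eta> (ball \<tau> \<rho>2)"
    by (rule has_complex_derivative_locally_invertible[OF \<eta>(2) _ open_ball \<eta>(4)]) (use \<eta>(1) in auto)
  obtain \<kappa> where \<kappa>: "\<kappa> holomorphic_on \<zeta> ` ball c0 \<rho>1"
    "\<And>z. z \<in> ball c0 \<rho>1 \<Longrightarrow> deriv \<zeta> z * deriv \<kappa> (\<zeta> z) = 1"
    "\<And>z. z \<in> ball c0 \<rho>1 \<Longrightarrow> \<kappa> (\<zeta> z) = z"
    using holomorphic_has_inverse[OF holomorphic_on_subset[OF \<zeta>(2) \<rho>1(2)] open_ball \<rho>1(4)] by metis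
  obtain \<delta>1 where \<delta>1: "\<delta>1 > 0" "\<And>t. t \<in> T \<Longrightarrow> \<bar>t - t0\<bar> < \<delta>1 \<Longrightarrow> \<gamma> t \<in> ball c0 \<rho>1"
    using assms(4,5) \<rho>1(1) unfolding continuous_on_iff c0_def
    by (metis dist_commute dist_real_def mem_ball)
  define \<delta> where "\<delta> = min \<delta>1 \<rho>2"
  define S where "S = (T - {t0}) \<inter> {t0 - \<delta><..<t0 + \<delta>}"
  have inb: "of_real t \<in> ball \<tau> d \<longleftrightarrow> \<bar>t - t0\<bar> < d" for t d
    unfolding \<tau>_def mem_ball dist_norm by (metis norm_of_real of_real_diff abs_minus_commute)
  have S: "t \<in> T" "t \<noteq> t0" "\<gamma> t \<in> ball c0 \<rho>1" "of_real t \<in> ball \<tau> \<rho>2" if "t \<in> S" for t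
    using that \<delta>1(2)[of t] unfolding inb S_def \<delta>_def by auto
  have \<eta>0: "\<eta> (of_real t) \<noteq> 0" if "t \<in> S" for t
    using inj_onD[OF \<rho>2(3), of "of_real t" \<tau>] S[OF that] \<eta>(3) \<rho>2(1) by (auto simp: \<tau>_def)
  have pow: "\<zeta> (\<gamma> t) ^ n = \<eta> (of_real t) ^ n" if "t \<in> S" for t
  proof -
    have m: "\<gamma> t \<in> ball c0 r1" "of_real t \<in> ball \<tau> r2"
      using S(3,4)[OF that] \<rho>1(2) \<rho>2(2) by blast+
    show ?thesis
      using \<zeta>(5)[OF m(1)] \<eta>(5)[OF m(2)] eq[OF S(1)[OF that]] eq[OF assms(4)] by (simp add: c0_def \<tau>_def)
  qed
  \<comment> \<open>The quotient of the two roots takes its values in the finite set of roots of unity.\<close>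
  define \<omega> where "\<omega> = (\<lambda>t. \<zeta> (\<gamma> t) / \<eta> (of_real t))"
  have unity: "\<omega> t ^ n = 1" if "t \<in> S" for t
    using pow[OF that] \<eta>0[OF that] by (simp add: \<omega>_def power_divide)
  have "\<exists>a. a \<noteq> 0 \<and> (\<forall>t\<in>S. \<omega> t = a)"
  proof (cases "n = 1 \<or> S = {}")
    case True
    then show ?thesis using unity by (intro exI[of _ 1]) auto
  next
    case False
    then have "is_interval S" unfolding S_def using T by (intro is_interval_Int) auto
    then have "connected S" by (rule is_interval_connected)
    moreover have "continuous_on S \<omega>" unfolding \<omega>_def
    proof (intro continuous_on_divide)
      show "continuous_on S (\<lambda>t. \<zeta> (\<gamma> t))"
        using S \<rho>1(2) by (intro continuous_on_compose2[OF holomorphic_on_imp_continuous_on[OF \<zeta>(2)]]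
            continuous_on_subset[OF assms(5)]) auto
      show "continuous_on S (\<lambda>t. \<eta> (of_real t))"
        using S(4) \<rho>2(2) by (intro continuous_on_compose2[OF holomorphic_on_imp_continuous_on[OF \<eta>(2)]]
            continuous_intros) auto
    qed (use \<eta>0 in blast)
    moreover have "finite (\<omega> ` S)"
      using unity assms(3) by (intro finite_subset[OF _ finite_roots_unity[of n]]) auto
    ultimately have "\<omega> constant_on S" by (rule continuous_finite_range_constant)
    then obtain a where a: "\<forall>t\<in>S. \<omega> t = a" by (auto simp: constant_on_def)
    obtain t where "t \<in> S" using False by blast
    then have "a ^ n = 1" using unity a by metis
    then have "a \<noteq> 0" using assms(3) by (metis power_0_left less_numeral_extra(3) zero_neq_one)
    with a show ?thesis by blast
  qed
  then obtain a where a: "a \<noteq> 0" "\<And>t. t \<in> S \<Longrightarrow> \<omega> t = a" by blast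
  have lift: "\<zeta> (\<gamma> t) = a * \<eta> (of_real t)" if "t \<in> T" "\<bar>t - t0\<bar> < \<delta>" for t
  proof (cases "t = t0")
    case True then show ?thesis using \<zeta>(3) \<eta>(3) by (simp add: c0_def \<tau>_def)
  next
    case False
    then have "t \<in> S" using that by (auto simp: S_def)
    then show ?thesis using a(2) \<eta>0 unfolding \<omega>_def by (metis nonzero_divide_eq_eq)
  qed
  have \<eta>hol: "(\<lambda>z. a * \<eta> z) holomorphic_on ball \<tau> r2" by (intro holomorphic_intros \<eta>(2))
  have "open (ball \<tau> r2 \<inter> (\<lambda>z. a * \<eta> z) -` (\<zeta> ` ball c0 \<rho>1))"
    by (rule continuous_open_preimage[OF holomorphic_on_imp_continuous_on[OF \<eta>hol] open_ball \<rho>1(3)])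
  moreover have 0: "0 \<in> \<zeta> ` ball c0 \<rho>1" using \<zeta>(3) \<rho>1(1) by (metis centre_in_ball image_eqI)
  then have "\<tau> \<in> ball \<tau> r2 \<inter> (\<lambda>z. a * \<eta> z) -` (\<zeta> ` ball c0 \<rho>1)" using \<eta>(1,3) by simp
  ultimately obtain \<epsilon> where \<epsilon>: "\<epsilon> > 0" "ball \<tau> \<epsilon> \<subseteq> ball \<tau> r2 \<inter> (\<lambda>z. a * \<eta> z) -` (\<zeta> ` ball c0 \<rho>1)"
    by (meson open_contains_ball)
  define f where "f = (\<lambda>z. \<kappa> (a * \<eta> z))"
  have "f holomorphic_on ball \<tau> \<epsilon>"
    unfolding f_def using holomorphic_on_compose_gen[OF holomorphic_on_subset[OF \<eta>hol, of "ball \<tau> \<epsilon>"] \<kappa>(1)] \<epsilon>(2)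
    by (auto simp: o_def)
  moreover have "deriv f \<tau> \<noteq> 0"
  proof -
    have k: "(\<kappa> has_field_derivative deriv \<kappa> (a * \<eta> \<tau>)) (at (a * \<eta> \<tau>))"
      by (rule holomorphic_derivI[OF \<kappa>(1) \<rho>1(3)]) (use 0 \<eta>(3) in simp)
    have e: "((\<lambda>z. a * \<eta> z) has_field_derivative a * deriv \<eta> \<tau>) (at \<tau>)"
      by (rule DERIV_cmult[OF holomorphic_derivI[OF \<eta>(2) open_ball]]) (use \<eta>(1) in simp)
    have "(f has_field_derivative deriv \<kappa> (a * \<eta> \<tau>) * (a * deriv \<eta> \<tau>)) (at \<tau>)"
      unfolding f_def by (rule DERIV_chain2[OF k e])
    moreover have "deriv \<kappa> (a * \<eta> \<tau>) \<noteq> 0"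
      using \<kappa>(2)[of c0] \<rho>1(1) \<zeta>(3) \<eta>(3) by auto
    ultimately show ?thesis using a(1) \<eta>(4) DERIV_imp_deriv by fastforce
  qed
  moreover have "\<gamma> t = f (of_real t)" if "t \<in> T" "\<bar>t - t0\<bar> < min \<epsilon> \<delta>" for t
    using \<kappa>(3)[of "\<gamma> t"] \<delta>1(2)[of t] lift[of t] that by (simp add: f_def \<delta>_def)
  ultimately show ?thesis unfolding \<tau>_def using \<epsilon>(1) \<delta>1(1) \<rho>2(1)
    by (intro exI[of _ "min \<epsilon> \<delta>"] conjI exI[of _ f]) (auto simp: \<delta>_def intro: holomorphic_on_subset)
qed

text \<open>
  Two of the given local extensions whose discs meet agree on a real interval between their
  centres, which lies in \<open>[0, 1]\<close> where both equal \<open>\<gamma>\<close>; the identity theorem makes them agree on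
  the whole intersection of the discs.
\<close>
lemma analytic_patching:
  fixes \<gamma> :: "real \<Rightarrow> complex"
  assumes loc: "\<And>t0. t0 \<in> {0..1} \<Longrightarrow>
     \<exists>r>0. \<exists>f. f holomorphic_on ball (of_real t0) r \<and> deriv f (of_real t0) \<noteq> 0 \<and>
       (\<forall>t\<in>{0..1}. \<bar>t - t0\<bar> < r \<longrightarrow> \<gamma> t = f (of_real t))"
  shows "\<exists>f. f analytic_on complex_of_real ` {0..1} \<and>
     (\<forall>t\<in>{0..1}. \<gamma> t = f (of_real t) \<and> deriv f (of_real t) \<noteq> 0)"
proof -
  obtain r f where rf: "\<And>s. s \<in> {0..1} \<Longrightarrow> r s > (0::real)"
    "\<And>s. s \<in> {0..1} \<Longrightarrow> f s holomorphic_on ball (of_real s) (r s)"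
    "\<And>s. s \<in> {0..1} \<Longrightarrow> deriv (f s) (of_real s) \<noteq> (0::complex)"
    "\<And>s t. \<lbrakk>s \<in> {0..1}; t \<in> {0..1}; \<bar>t - s\<bar> < r s\<rbrakk> \<Longrightarrow> \<gamma> t = f s (of_real t)"
    using loc by metis
  define B where "B = (\<lambda>s. ball (complex_of_real s) (r s))"
  have inB: "of_real t \<in> B s \<longleftrightarrow> \<bar>t - s\<bar> < r s" for s t
    unfolding B_def mem_ball dist_norm by (metis norm_of_real of_real_diff abs_minus_commute)
  have agree': "f s z = f t z" if st: "s \<in> {0..1}" "t \<in> {0..1}" "s < t" and z: "z \<in> B s" "z \<in> B t" for s t z
  proof -
    \<comment> \<open>The real points of the intersection of the two discs that lie between the centres.\<close>
    define a b where "a = max s (t - r t)" and "b = min t (s + r s)"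
    have "dist (complex_of_real s) (of_real t) < r s + r t"
      using z dist_triangle_lt[of "of_real s" z "of_real t"] unfolding B_def
      by (smt (verit) dist_commute dist_triangle mem_ball)
    moreover have "dist (complex_of_real s) (of_real t) = t - s"
      using st unfolding dist_norm by (metis abs_minus_commute abs_of_pos diff_gt_0_iff_gt norm_of_real of_real_diff)
    ultimately have ab: "a < b" using st rf(1)[of s] rf(1)[of t] by (auto simp: a_def b_def)
    have sub: "of_real ` {a<..<b} \<subseteq> B s \<inter> B t"
      by (auto simp: inB a_def b_def)
    define m where "m = (a + b) / 2"
    have "f s z - f t z = 0"
    proof (rule analytic_continuation[of "\<lambda>z. f s z - f t z" "B s \<inter> B t" "of_real ` {a<..<b}" "of_real m"])
      show "(\<lambda>z. f s z - f t z) holomorphic_on B s \<inter> B t"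
        unfolding B_def using rf(2)[OF st(1)] rf(2)[OF st(2)]
        by (intro holomorphic_on_diff) (auto elim: holomorphic_on_subset)
      show "open (B s \<inter> B t)" "connected (B s \<inter> B t)"
        unfolding B_def by (auto intro: convex_connected convex_Int)
      have "m \<in> {a<..<b}" using ab by (auto simp: m_def)
      then show "of_real m \<in> B s \<inter> B t" using sub by blast
      show "complex_of_real m islimpt of_real ` {a<..<b}"
        unfolding islimpt_approachable
      proof (intro allI impI)
        fix e :: real assume "e > 0"
        define x where "x = m + min (e / 2) ((b - m) / 2)"
        have "x \<in> {a<..<b}" "x \<noteq> m" "\<bar>x - m\<bar> < e" using \<open>e > 0\<close> ab by (auto simp: x_def m_def min_def field_simps)
        then show "\<exists>x'\<in>complex_of_real ` {a<..<b}. x' \<noteq> complex_of_real m \<and> dist x' (complex_of_real m) < e"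
          by (intro bexI[of _ "of_real x"]) (auto simp: dist_norm simp flip: of_real_diff)
      qed
      show "f s w - f t w = 0" if w: "w \<in> of_real ` {a<..<b}" for w
      proof -
        obtain x where x: "w = of_real x" "x \<in> {a<..<b}" using w by blast
        then have "w \<in> B s" "w \<in> B t" using sub by auto
        then have "\<bar>x - s\<bar> < r s" "\<bar>x - t\<bar> < r t" using x inB by auto
        moreover have "x \<in> {0..1}" using x st by (auto simp: a_def b_def)
        ultimately show ?thesis using rf(4)[of s x] rf(4)[of t x] st x by simp
      qed
    qed (use sub z in auto)
    then show ?thesis by simp
  qed
  have agree: "f s z = f t z" if "s \<in> {0..1}" "t \<in> {0..1}" "z \<in> B s" "z \<in> B t" for s t z
    using agree'[of s t z] agree'[of t s z] that by (metis linorder_neqE)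
  define g where "g = (\<lambda>z. f (SOME t. t \<in> {0..1} \<and> z \<in> B t) z)"
  have g: "g z = f t z" if "t \<in> {0..1}" "z \<in> B t" for t z
  proof -
    have "(SOME t. t \<in> {0..1} \<and> z \<in> B t) \<in> {0..1} \<and> z \<in> B (SOME t. t \<in> {0..1} \<and> z \<in> B t)"
      by (rule someI[of "\<lambda>t. t \<in> {0..1} \<and> z \<in> B t" t]) (use that in blast)
    then show ?thesis unfolding g_def using agree that by blast
  qed
  have oB: "open (B t)" "of_real t \<in> B t" if "t \<in> {0..1}" for t
    using rf(1)[OF that] by (auto simp: B_def)
  have "g analytic_on complex_of_real ` {0..1}"
    unfolding analytic_on_def
  proof
    fix w assume "w \<in> complex_of_real ` {0..1}"
    then obtain t where t: "t \<in> {0..1}" "w = of_real t" by blast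
    have "g holomorphic_on ball w (r t)"
      using holomorphic_transform[OF rf(2)[OF t(1)]] g[OF t(1)] t(2) unfolding B_def by metis
    then show "\<exists>e>0. g holomorphic_on ball w e" using rf(1)[OF t(1)] by blast
  qed
  moreover have "\<gamma> t = g (of_real t) \<and> deriv g (of_real t) \<noteq> 0" if t: "t \<in> {0..1}" for t
  proof
    show "\<gamma> t = g (of_real t)" using rf(4)[OF t t] rf(1)[OF t] g[OF t oB(2)[OF t]] by simp
    have "eventually (\<lambda>z. g z = f t z) (nhds (of_real t))"
      using eventually_nhds_in_open[OF oB[OF t]] by eventually_elim (rule g[OF t])
    then have "deriv g (of_real t) = deriv (f t) (of_real t)" by (rule deriv_cong_ev) simp
    then show "deriv g (of_real t) \<noteq> 0" using rf(3)[OF t] by simp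
  qed
  ultimately show ?thesis by blast
qed

section \<open>Branches of the square root along a trajectory\<close>

lemma vector_derivative_of_real_comp:
  assumes f: "f analytic_on complex_of_real ` {0..1}"
    and eq: "\<forall>t\<in>{0..1}. \<gamma> t = f (complex_of_real t)" and t: "t \<in> {0<..<1}"
  shows "(\<gamma> has_vector_derivative deriv f (of_real t)) (at t)"
proof -
  have "f field_differentiable at (of_real t)"
    using f t by (intro analytic_on_imp_differentiable_at) auto
  then have "(f has_field_derivative deriv f (of_real t)) (at (of_real t))"
    by (rule field_differentiable_derivI)
  then have "((\<lambda>t. f (of_real t)) has_vector_derivative deriv f (of_real t)) (at t)"
    by (rule has_vector_derivative_real_field)
  then show ?thesis
    by (rule has_vector_derivative_transform_within_open[of _ _ _ "{0<..<1}"]) (use eq t in auto)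
qed

text \<open>
  Along the trajectory the branch has the closed form \<open>\<i> * sqrt (- Q \<gamma>'\<^sup>2) / \<gamma>'\<close> with a
  nonnegative real radicand. It is continuous up to the end points because \<open>\<gamma>'\<close> does not vanish
  there.
\<close>
lemma trajectory_sqrt_branch:
  assumes "trajectory Q \<gamma>" "Q (pathstart \<gamma>) = 0" "Q (pathfinish \<gamma>) = 0" "continuous_on UNIV Q"
  shows "\<exists>R. continuous_on (path_image \<gamma>) R \<and> (\<forall>z\<in>path_image \<gamma>. (R z)\<^sup>2 = Q z)"
proof -
  obtain f where arc: "arc \<gamma>" and f: "f analytic_on complex_of_real ` {0..1}"
    "\<forall>t\<in>{0..1}. \<gamma> t = f (complex_of_real t)" "\<And>t. t \<in> {0..1} \<Longrightarrow> deriv f (complex_of_real t) \<noteq> 0"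
    using assms(1) unfolding trajectory_def analytic_arc_def by blast
  have c\<gamma>: "continuous_on {0..1} \<gamma>" using arc by (simp add: arc_def path_def)
  have cd: "continuous_on {0..1} (\<lambda>t::real. deriv f (of_real t))"
    by (rule continuous_on_compose2[OF holomorphic_on_imp_continuous_on[OF analytic_imp_holomorphic[OF analytic_deriv[OF f(1)]]]])
       (auto intro: continuous_intros)
  define \<phi> where "\<phi> = (\<lambda>t. Re (Q (\<gamma> t) * (deriv f (of_real t))\<^sup>2))"
  have \<phi>: "Q (\<gamma> t) * (deriv f (of_real t))\<^sup>2 = of_real (\<phi> t) \<and> \<phi> t \<le> 0" if t: "t \<in> {0..1}" for t
  proof -
    consider "t = 0 \<or> t = 1" | "t \<in> {0<..<1}" using t by force
    then show ?thesis
    proof cases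
      case 1
      then have "Q (\<gamma> t) = 0" using assms(2,3) by (auto simp: pathstart_def pathfinish_def)
      then show ?thesis by (simp add: \<phi>_def)
    next
      case 2
      then have "vector_derivative \<gamma> (at t) = deriv f (of_real t)"
        by (intro vector_derivative_at vector_derivative_of_real_comp f)
      then show ?thesis using assms(1) 2 unfolding trajectory_def \<phi>_def
        by (metis less_imp_le of_real_Re)
    qed
  qed
  define \<rho> where "\<rho> = (\<lambda>t. \<i> * of_real (sqrt (- \<phi> t)) / deriv f (of_real t))"
  have "continuous_on {0..1} (\<lambda>t. Q (\<gamma> t))"
    by (rule continuous_on_compose2[OF assms(4) c\<gamma>]) simp
  then have c\<rho>: "continuous_on {0..1} \<rho>" unfolding \<rho>_def \<phi>_def
    by (intro continuous_intros cd) (use f(3) in auto)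
  have \<rho>2: "(\<rho> t)\<^sup>2 = Q (\<gamma> t)" if "t \<in> {0..1}" for t
  proof -
    have "(\<i> * of_real (sqrt (- \<phi> t)))\<^sup>2 = complex_of_real (\<phi> t)"
      using \<phi>[OF that] by (simp add: power_mult_distrib flip: of_real_power)
    then show ?thesis using \<phi>[OF that] f(3)[OF that] unfolding \<rho>_def power_divide by (metis nonzero_eq_divide_eq power_not_zero)
  qed
  define inv\<gamma> where "inv\<gamma> = inv_into {0..1} \<gamma>"
  have inj: "inj_on \<gamma> {0..1}" using arc by (simp add: arc_def)
  have i: "inv\<gamma> (\<gamma> t) = t" if "t \<in> {0..1}" for t
    unfolding inv\<gamma>_def using inj that by (rule inv_into_f_f)
  have "continuous_on (path_image \<gamma>) inv\<gamma>"
    unfolding path_image_def by (rule continuous_on_inv[OF c\<gamma>]) (use i in auto)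
  then have "continuous_on (path_image \<gamma>) (\<lambda>z. \<rho> (inv\<gamma> z))"
    by (rule continuous_on_compose2[OF c\<rho>]) (auto simp: path_image_def i)
  moreover have "(\<rho> (inv\<gamma> z))\<^sup>2 = Q z" if "z \<in> path_image \<gamma>" for z
    using that \<rho>2 i by (auto simp: path_image_def)
  ultimately show ?thesis by (intro exI[of _ "\<lambda>z. \<rho> (inv\<gamma> z)"]) blast
qed

text \<open>
  The integrand \<open>R \<gamma>'\<close> has the negative real square \<open>Q \<gamma>'\<^sup>2\<close>, whatever branch \<open>R\<close> is used, so it
  is purely imaginary except possibly at the two end points.
\<close>
lemma trajectory_contour_integral_real:
  assumes "trajectory Q \<gamma>" "\<forall>z\<in>path_image \<gamma>. (R z)\<^sup>2 = Q z" "t \<in> {0..1}"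
  shows "1 / (complex_of_real pi * \<i>) * contour_integral (subpath 0 t \<gamma>) R \<in> \<real>"
proof (cases "R contour_integrable_on subpath 0 t \<gamma>")
  case False
  then show ?thesis by (simp add: not_integrable_contour_integral)
next
  case True
  define I where "I = contour_integral (subpath 0 t \<gamma>) R"
  define D where "D = (\<lambda>x. R (subpath 0 t \<gamma> x) * vector_derivative (subpath 0 t \<gamma>) (at x))"
  obtain f where f: "f analytic_on complex_of_real ` {0..1}"
    "\<forall>t\<in>{0..1}. \<gamma> t = f (complex_of_real t)"
    using assms(1) unfolding trajectory_def analytic_arc_def by blast
  have "Re (D x) = 0" if x: "x \<in> {0<..<1}" for x
  proof -
    have sp: "subpath 0 t \<gamma> = (\<lambda>x. \<gamma> (t * x))" by (simp add: subpath_def fun_eq_iff)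
    show ?thesis
    proof (cases "t = 0")
      case True
      then have "subpath 0 t \<gamma> = (\<lambda>x. \<gamma> 0)" by (simp add: subpath_def fun_eq_iff)
      then show ?thesis by (simp add: D_def)
    next
      case False
      then have "0 < t * x" "t * x \<le> 1 * x"
        using x assms(3) by (auto intro!: mult_pos_pos mult_right_mono)
      then have tx: "t * x \<in> {0<..<1}" using x by auto
      have d: "(\<gamma> has_vector_derivative deriv f (of_real (t * x))) (at (t * x))"
        by (rule vector_derivative_of_real_comp[OF f tx])
      then have v: "vector_derivative \<gamma> (at (t * x)) = deriv f (of_real (t * x))"
        by (rule vector_derivative_at)
      have "((\<lambda>x. t * x) has_vector_derivative t) (at x)"
        by (auto intro!: derivative_eq_intros simp: has_real_derivative_iff_has_vector_derivative[symmetric])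
      then have "((\<gamma> \<circ> (\<lambda>x. t * x)) has_vector_derivative t *\<^sub>R deriv f (of_real (t * x))) (at x)"
        using d by (rule vector_diff_chain_at)
      then have Dx: "D x = of_real t * (R (\<gamma> (t * x)) * deriv f (of_real (t * x)))"
        unfolding D_def sp o_def by (simp add: vector_derivative_at scaleR_conv_of_real)
      moreover have "\<gamma> (t * x) \<in> path_image \<gamma>" using tx by (auto simp: path_image_def)
      then have "(R (\<gamma> (t * x)) * deriv f (of_real (t * x)))\<^sup>2 = Q (\<gamma> (t * x)) * (deriv f (of_real (t * x)))\<^sup>2"
        using assms(2) by (simp add: power_mult_distrib)
      then have "(R (\<gamma> (t * x)) * deriv f (of_real (t * x)))\<^sup>2 \<in> \<real>"
         "Re ((R (\<gamma> (t * x)) * deriv f (of_real (t * x)))\<^sup>2) < 0"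
        using assms(1) tx v unfolding trajectory_def by metis+
      moreover have "Re w = 0" if "w\<^sup>2 \<in> \<real>" "Re (w\<^sup>2) < 0" for w :: complex
        using that by (auto simp: complex_is_Real_iff power2_eq_square)
      ultimately have "Re (R (\<gamma> (t * x)) * deriv f (of_real (t * x))) = 0" by blast
      then have "t * Re (R (\<gamma> (t * x)) * deriv f (of_real (t * x))) = 0" by (simp only: mult_zero_right)
      moreover have "Re (of_real t * w) = t * Re w" for w by simp
      ultimately show ?thesis unfolding Dx by (simp only:)
    qed
  qed
  then have "((\<lambda>x. Re (D x)) has_integral 0) {0..1}"
    by (intro has_integral_spike_finite[OF _ _ has_integral_0, of "{0,1}"]) auto
  moreover have "(D has_integral I) {0..1}"
    using has_contour_integral_integral[OF True] unfolding has_contour_integral I_def D_def .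
  then have "((\<lambda>x. Re (D x)) has_integral Re I) {0..1}"
    using has_integral_linear[OF _ bounded_linear_Re] by (simp add: o_def)
  ultimately have "Re I = 0" by (rule has_integral_unique[symmetric])
  then show ?thesis unfolding I_def[symmetric] by (simp add: complex_is_Real_iff Im_divide)
qed

section \<open>The order of a zero from a differential equation\<close>

lemma factorization_order_unique:
  fixes A B :: "complex \<Rightarrow> complex"
  assumes "r > 0" "A holomorphic_on ball c r" "B holomorphic_on ball c r" "A c \<noteq> 0" "B c \<noteq> 0"
    and "\<And>z. z \<in> ball c r \<Longrightarrow> (z - c) ^ m * A z = (z - c) ^ n * B z"
  shows "m = n"
proof -
  have "zorder (\<lambda>z. (z - c) ^ m * A z) c = int m"
    by (rule zorder_eqI[OF open_ball _ assms(2,4)]) (use assms(1) in auto)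
  moreover have "zorder (\<lambda>z. (z - c) ^ m * A z) c = int n"
    by (rule zorder_eqI[OF open_ball _ assms(3,5)]) (use assms(1,6) in \<open>auto simp: mult.commute\<close>)
  ultimately show ?thesis by simp
qed

text \<open>
  If \<open>F\<close> vanishes to order \<open>n\<close>, then the two sides of the equation vanish to the orders
  \<open>2 * (n - 1)\<close> and \<open>n + 1\<close>, so \<open>n = 3\<close>.
\<close>
lemma has_cube_root_at_if_ode:
  assumes F: "F holomorphic_on UNIV" and nc: "\<not> F constant_on UNIV" and c: "F c = 0"
    and k: "k holomorphic_on UNIV" "k c \<noteq> 0"
    and ode: "\<And>z. (deriv F z)\<^sup>2 = F z * ((z - c) * k z)"
  shows "has_nth_root_at F c 3"
proof -
  obtain h r n where h: "0 < n" "0 < r" "h holomorphic_on ball c r"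
    "\<And>z. z \<in> ball c r \<Longrightarrow> F z = (z - c) ^ n * h z" "\<And>z. z \<in> ball c r \<Longrightarrow> h z \<noteq> 0"
    by (rule holomorphic_factor_zero_nonconstant[OF F open_UNIV connected_UNIV UNIV_I c nc]) blast
  define A where "A = (\<lambda>z. (of_nat n * h z + (z - c) * deriv h z)\<^sup>2)"
  define B where "B = (\<lambda>z. h z * k z)"
  have cb: "c \<in> ball c r" using h(2) by simp
  have d: "deriv F z = (z - c) ^ (n - 1) * (of_nat n * h z + (z - c) * deriv h z)" if z: "z \<in> ball c r" for z
  proof -
    have hd: "(h has_field_derivative deriv h z) (at z)"
      by (rule holomorphic_derivI[OF h(3) open_ball z])
    have "((\<lambda>z. (z - c) ^ n * h z) has_field_derivative
        of_nat n * (z - c) ^ (n - 1) * h z + (z - c) ^ n * deriv h z) (at z)"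
      by (auto intro!: derivative_eq_intros hd)
    then have "(F has_field_derivative of_nat n * (z - c) ^ (n - 1) * h z + (z - c) ^ n * deriv h z) (at z)"
      by (rule has_field_derivative_transform_within_open[OF _ open_ball z]) (use h(4) in auto)
    moreover have "(z - c) ^ n = (z - c) ^ (n - 1) * (z - c)"
      using h(1) by (metis power_minus_mult)
    ultimately show ?thesis by (simp add: DERIV_imp_deriv algebra_simps)
  qed
  have "2 * (n - 1) = n + 1"
  proof (rule factorization_order_unique[of r A c B])
    show "A holomorphic_on ball c r" unfolding A_def
      by (intro holomorphic_intros h(3) holomorphic_deriv open_ball)
    show "B holomorphic_on ball c r" unfolding B_def
      by (intro holomorphic_intros h(3) holomorphic_on_subset[OF k(1)]) simp
    show "A c \<noteq> 0" "B c \<noteq> 0" using h(1) h(5)[OF cb] k(2) by (auto simp: A_def B_def)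
    fix z assume z: "z \<in> ball c r"
    have "(z - c) ^ (2 * (n - 1)) * A z = (deriv F z)\<^sup>2"
      unfolding d[OF z] A_def power_mult_distrib by (simp add: power_mult mult.commute flip: power_mult)
    also have "\<dots> = (z - c) ^ (n + 1) * B z"
      unfolding ode B_def h(4)[OF z] by (simp add: algebra_simps)
    finally show "(z - c) ^ (2 * (n - 1)) * A z = (z - c) ^ (n + 1) * B z" .
  qed (use h in auto)
  then have "n = 3" using h(1) by linarith
  then show ?thesis
    using has_nth_root_atI[of r h c 3 F] h cb c by simp
qed

section \<open>The critical trajectory\<close>

text \<open>
  The polynomial of degree five that rises from \<open>0\<close> to \<open>1\<close> on \<open>[0, 1]\<close> with contact of order
  three at both ends. It is needed over the reals and over the complex numbers.
\<close>
definition smoothstep :: "'a::comm_ring_1 \<Rightarrow> 'a" where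
  "smoothstep t = t ^ 3 * (10 - 15 * t + 6 * t\<^sup>2)"

lemma one_minus_smoothstep: "1 - smoothstep t = (1 - t) ^ 3 * (1 + 3 * t + 6 * t\<^sup>2)"
  by (simp add: smoothstep_def power2_eq_square power3_eq_cube algebra_simps)

lemma smoothstep_of_real: "smoothstep (complex_of_real t) = of_real (smoothstep t)"
  by (simp add: smoothstep_def)

lemma smoothstep_deriv:
  "(smoothstep has_field_derivative 30 * t\<^sup>2 * (1 - t)\<^sup>2) (at (t::'a::real_normed_field))"
proof -
  have "(smoothstep has_field_derivative 3 * t\<^sup>2 * (10 - 15 * t + 6 * t\<^sup>2) + t ^ 3 * (12 * t - 15)) (at t)"
    unfolding smoothstep_def
    by (auto intro!: derivative_eq_intros simp: power2_eq_square power3_eq_cube algebra_simps)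
  also have "3 * t\<^sup>2 * (10 - 15 * t + 6 * t\<^sup>2) + t ^ 3 * (12 * t - 15) = 30 * t\<^sup>2 * (1 - t)\<^sup>2"
    by (simp add: power2_eq_square power3_eq_cube algebra_simps)
  finally show ?thesis .
qed

lemma smoothstep_strict_mono:
  assumes "0 \<le> s" "s < t" "t \<le> (1::real)"
  shows "smoothstep s < smoothstep t"
proof (rule DERIV_pos_imp_increasing_open[OF assms(2)])
  show "continuous_on {s..t} (smoothstep :: real \<Rightarrow> real)"
    unfolding smoothstep_def by (intro continuous_intros)
  fix x assume "s < x" "x < t"
  then have "0 < 30 * x\<^sup>2 * (1 - x)\<^sup>2" using assms by simp
  then show "\<exists>y. (smoothstep has_real_derivative y) (at x) \<and> 0 < y"
    using smoothstep_deriv[of x] by blast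
qed

lemma smoothstep_ends: "smoothstep 0 = (0 :: 'a :: comm_ring_1)" "smoothstep 1 = (1 :: 'a)"
  by (simp_all add: smoothstep_def)

lemma smoothstep_bounds:
  "t \<in> {0..1} \<Longrightarrow> smoothstep t \<in> {0..1::real}"
  "t \<in> {0<..<1} \<Longrightarrow> smoothstep t \<in> {0<..<1::real}"
  using smoothstep_strict_mono[of 0 t] smoothstep_strict_mono[of t 1] smoothstep_ends[where 'a=real]
  by (cases "t = 0"; cases "t = 1"; force)+

lemma smoothstep_roots:
  "has_nth_root_at smoothstep 0 3" "has_nth_root_at (\<lambda>z. 1 - smoothstep z) 1 3"
proof -
  show "has_nth_root_at smoothstep 0 3"
    by (rule has_nth_root_atI[of 1 "\<lambda>z. 10 - 15 * z + 6 * z\<^sup>2"])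
       (auto simp: smoothstep_def intro!: holomorphic_intros)
  show "has_nth_root_at (\<lambda>z. 1 - smoothstep z) 1 3"
  proof (rule has_nth_root_atI[of 1 "\<lambda>z. - (1 + 3 * z + 6 * z\<^sup>2)"])
    show "(1 - smoothstep z) - (1 - smoothstep 1) = (z - 1) ^ 3 * - (1 + 3 * z + 6 * z\<^sup>2)" for z :: complex
      unfolding one_minus_smoothstep by (simp add: power3_eq_cube algebra_simps)
  qed (auto intro!: holomorphic_intros)
qed

text \<open>
  Here the arc is described in the coordinate \<open>c = (z - \<i>) / sqrt 2\<close>, which sends the simple
  zeros of \<open>Q\<close> to \<open>\<plusminus> 1\<close>. Prescribing \<open>cos\<^sup>2 (s / 4) = smoothstep t\<close> fixes the parameter \<open>s\<close> of
  \<open>level_curve\<close> as a function of \<open>t\<close>, and the arc traverses the curve backwards, from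
  \<open>s = 2 * pi\<close> to \<open>s = 0\<close>. Interior points are unramified since none of the factors in the
  differential equation vanishes there.
\<close>
lemma normalized_arc:
  "\<exists>H g. H holomorphic_on UNIV \<and>
     (\<forall>c. (deriv H c)\<^sup>2 = H c * (1 - H c) * (1 - c\<^sup>2) * (2 - of_real (sqrt 2) * \<i> * c)\<^sup>2) \<and>
     continuous_on {0..1} g \<and> g 0 = -1 \<and> g 1 = 1 \<and>
     (\<forall>t\<in>{0..1}. H (g t) = of_real (smoothstep t)) \<and>
     (\<exists>f. f analytic_on complex_of_real ` {0..1} \<and>
        (\<forall>t\<in>{0..1}. g t = f (of_real t) \<and> deriv f (of_real t) \<noteq> 0))"
proof -
  obtain H where H: "H holomorphic_on UNIV" "\<forall>u. H (cos u) = (cos (phase u / 4))\<^sup>2"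
    "\<forall>c. (deriv H c)\<^sup>2 = H c * (1 - H c) * (1 - c\<^sup>2) * (2 - of_real (sqrt 2) * \<i> * c)\<^sup>2"
    using uniformizing_function by blast
  obtain U where U: "continuous_on {0..2 * pi} U" "U 0 = 0" "U (2 * pi) = of_real pi"
    "\<And>s. s \<in> {0..2 * pi} \<Longrightarrow> phase (U s) = of_real s"
    "\<And>s. s \<in> {0<..<2 * pi} \<Longrightarrow> - sqrt 2 < Im (cos (U s))"
    using level_curve by blast
  \<comment> \<open>The solution \<open>s\<close> of \<open>cos\<^sup>2 (s / 4) = smoothstep t\<close> in \<open>[0, 2 * pi]\<close>.\<close>
  define \<sigma> where "\<sigma> = (\<lambda>t. 4 * arccos (sqrt (smoothstep t)))"
  have sq: "0 \<le> sqrt (smoothstep t)" "sqrt (smoothstep t) \<le> 1" if "t \<in> {0..1}" for t :: real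
    using smoothstep_bounds(1)[OF that] by auto
  have \<sigma>: "\<sigma> t \<in> {0..2 * pi}" if "t \<in> {0..1}" for t
    using arccos_lbound[of "sqrt (smoothstep t)"] arccos_le_pi2[of "sqrt (smoothstep t)"] sq[OF that]
    by (auto simp: \<sigma>_def)
  have c\<sigma>: "continuous_on {0..1} \<sigma>"
    unfolding \<sigma>_def
  proof (intro continuous_intros)
    show "continuous_on {0..1} (smoothstep :: real \<Rightarrow> real)"
      unfolding smoothstep_def by (intro continuous_intros)
    show "\<forall>t\<in>{0..1}. - 1 \<le> sqrt (smoothstep t) \<and> sqrt (smoothstep t) \<le> 1"
    proof
      fix t :: real assume "t \<in> {0..1}"
      then show "- 1 \<le> sqrt (smoothstep t) \<and> sqrt (smoothstep t) \<le> 1"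
        using sq[of t] by linarith
    qed
  qed
  define g where "g = (\<lambda>t. cos (U (\<sigma> t)))"
  have "continuous_on {0..1} (\<lambda>t. U (\<sigma> t))"
    by (rule continuous_on_compose2[OF U(1) c\<sigma>]) (use \<sigma> in blast)
  then have cg: "continuous_on {0..1} g" unfolding g_def by (intro continuous_intros)
  have g01: "g 0 = -1" "g 1 = 1"
    using U(2,3) by (simp_all add: g_def \<sigma>_def smoothstep_ends cos_of_real)
  have Hg: "H (g t) = of_real (smoothstep t)" if "t \<in> {0..1}" for t
  proof -
    have "H (g t) = (cos (of_real (arccos (sqrt (smoothstep t)))))\<^sup>2"
      using H(2) U(4)[OF \<sigma>[OF that]] by (simp add: g_def \<sigma>_def)
    also have "cos (arccos (sqrt (smoothstep t))) = sqrt (smoothstep t)"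
      using sq[OF that] by (intro cos_arccos) linarith+
    then have "(cos (of_real (arccos (sqrt (smoothstep t)))))\<^sup>2 = complex_of_real ((sqrt (smoothstep t))\<^sup>2)"
      by (simp only: cos_of_real of_real_power)
    finally show ?thesis using smoothstep_bounds(1)[OF that] by (simp flip: of_real_power)
  qed
  have H1: "H 1 = 1" "H (-1) = 0"
    using Hg[of 0] Hg[of 1] g01 smoothstep_ends[where 'a=real] by simp_all
  have nc: "\<not> H constant_on UNIV" using H1 by (metis UNIV_I constant_on_def zero_neq_one)
  have w: "2 - of_real (sqrt 2) * \<i> * c \<noteq> 0" if "- sqrt 2 < Im c" for c
  proof -
    have "sqrt 2 * - sqrt 2 < sqrt 2 * Im c" using that by (intro mult_strict_left_mono) auto
    then have "Re (2 - of_real (sqrt 2) * \<i> * c) \<noteq> 0" by simp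
    then show ?thesis by (metis zero_complex.sel(1))
  qed
  have root_m1: "has_nth_root_at H (-1) 3"
  proof (rule has_cube_root_at_if_ode[OF H(1) nc H1(2)])
    show "(\<lambda>c. (1 - H c) * (1 - c) * (2 - of_real (sqrt 2) * \<i> * c)\<^sup>2) holomorphic_on UNIV"
      by (intro holomorphic_intros H(1))
    show "(1 - H (-1)) * (1 - (-1)) * (2 - of_real (sqrt 2) * \<i> * (-1))\<^sup>2 \<noteq> 0"
      using w[of "-1"] H1 by simp
    show "(deriv H z)\<^sup>2 = H z * ((z - (-1)) * ((1 - H z) * (1 - z) * (2 - of_real (sqrt 2) * \<i> * z)\<^sup>2))" for z
      unfolding H(3)[rule_format] by (simp add: power2_eq_square[of z] algebra_simps)
  qed
  have root_1: "has_nth_root_at (\<lambda>c. 1 - H c) 1 3"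
  proof (rule has_cube_root_at_if_ode)
    show "(\<lambda>c. 1 - H c) holomorphic_on UNIV" by (intro holomorphic_intros H(1))
    show "\<not> (\<lambda>c. 1 - H c) constant_on UNIV" using H1
      by (metis (mono_tags, lifting) UNIV_I constant_on_def diff_self diff_zero zero_neq_one)
    show "(\<lambda>c. H c * - (1 + c) * (2 - of_real (sqrt 2) * \<i> * c)\<^sup>2) holomorphic_on UNIV"
      by (intro holomorphic_intros H(1))
    show "H 1 * - (1 + 1) * (2 - of_real (sqrt 2) * \<i> * 1)\<^sup>2 \<noteq> 0"
      using w[of 1] H1 by simp
    have "((\<lambda>c. 1 - H c) has_field_derivative 0 - deriv H z) (at z)" for z
      by (intro DERIV_diff DERIV_const holomorphic_derivI[OF H(1) open_UNIV UNIV_I])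
    then have dm: "deriv (\<lambda>c. 1 - H c) z = - deriv H z" for z using DERIV_imp_deriv by fastforce
    show "(deriv (\<lambda>c. 1 - H c) z)\<^sup>2 = (1 - H z) * ((z - 1) * (H z * - (1 + z) * (2 - of_real (sqrt 2) * \<i> * z)\<^sup>2))" for z
      unfolding dm power2_minus H(3)[rule_format] by (simp add: power2_eq_square[of z] algebra_simps)
  qed (simp add: H1)
  have "\<exists>r>0. \<exists>f. f holomorphic_on ball (of_real t0) r \<and> deriv f (of_real t0) \<noteq> 0 \<and>
       (\<forall>t\<in>{0..1}. \<bar>t - t0\<bar> < r \<longrightarrow> g t = f (of_real t))" if t0: "t0 \<in> {0..1}" for t0
  proof -
    consider "t0 = 0" | "t0 = 1" | "t0 \<in> {0<..<1}" using t0 by force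
    then show ?thesis
    proof cases
      case 1
      have "{0..1} - {0::real} = {0<..1}" by auto
      then show ?thesis unfolding 1
        by (intro local_lift[of H _ _ 3 smoothstep] cg)
           (use root_m1 smoothstep_roots g01 Hg in \<open>auto simp: smoothstep_of_real\<close>)
    next
      case 2
      have "{0..1} - {1::real} = {0..<1}" by auto
      then show ?thesis unfolding 2
        by (intro local_lift[of "\<lambda>c. 1 - H c" _ _ 3 "\<lambda>z. 1 - smoothstep z"] cg)
           (use root_1 smoothstep_roots g01 Hg in \<open>auto simp: smoothstep_of_real\<close>)
    next
      case 3
      have b: "0 < smoothstep t0" "smoothstep t0 < 1" using smoothstep_bounds(2)[OF 3] by auto
      have ht: "H (g t0) = of_real (smoothstep t0)" using Hg t0 by blast
      have "1 - H (g t0) = of_real (1 - smoothstep t0)" by (simp add: ht)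
      moreover have "1 - smoothstep t0 \<noteq> 0" using b by simp
      ultimately have nz: "H (g t0) \<noteq> 0" "1 - H (g t0) \<noteq> 0"
        using ht b(1) by (metis less_irrefl of_real_eq_0_iff, metis of_real_eq_0_iff)
      then have "g t0 \<noteq> 1" "g t0 \<noteq> -1" using H1 by auto
      then have "1 - (g t0)\<^sup>2 \<noteq> 0" by (auto simp: power2_eq_1_iff)
      moreover have "\<sigma> t0 \<noteq> 0" "\<sigma> t0 \<noteq> 2 * pi"
        using \<open>g t0 \<noteq> 1\<close> \<open>g t0 \<noteq> -1\<close> U(2,3) by (auto simp: g_def cos_of_real)
      then have "\<sigma> t0 \<in> {0<..<2 * pi}" using \<sigma>[OF t0] by auto
      then have "2 - of_real (sqrt 2) * \<i> * g t0 \<noteq> 0" using w U(5) by (simp add: g_def)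
      ultimately have "(deriv H (g t0))\<^sup>2 \<noteq> 0" using H(3) nz by simp
      then have "has_nth_root_at H (g t0) 1" by (intro has_nth_root_at_1 H(1)) auto
      moreover have "has_nth_root_at smoothstep (of_real t0) 1"
      proof (rule has_nth_root_at_1)
        show "smoothstep holomorphic_on (UNIV :: complex set)"
          unfolding smoothstep_def by (intro holomorphic_intros)
        have "complex_of_real (30 * t0\<^sup>2 * (1 - t0)\<^sup>2) \<noteq> 0" using 3 by (simp del: of_real_mult)
        then show "deriv smoothstep (complex_of_real t0) \<noteq> 0"
          using DERIV_imp_deriv[OF smoothstep_deriv[of "complex_of_real t0"]] by simp
      qed
      ultimately show ?thesis
        by (intro local_lift[of H _ _ 1 smoothstep] cg)
           (use Hg t0 in \<open>auto simp: smoothstep_of_real\<close>)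
    qed
  qed
  from analytic_patching[OF this] show ?thesis
    using H(1,3) cg g01 Hg by blast
qed

text \<open>
  With \<open>z = sqrt 2 * c + \<i>\<close> one has \<open>Q z = - (1 - c\<^sup>2) * (2 - sqrt 2 * \<i> * c)\<^sup>2 / 2\<close>; the
  assumption is the differential equation of \<open>H\<close> with \<open>D = H' (c)\<close>, and \<open>d\<close> is the velocity of
  \<open>c\<close>.
\<close>
lemma Q_along_arc:
  fixes c d q q' :: complex
  assumes "D\<^sup>2 = q * (1 - q) * (1 - c\<^sup>2) * (2 - of_real (sqrt 2) * \<i> * c)\<^sup>2"
    and "D * d = q'"
  shows "q * (1 - q) * (- (1 / 4) * (of_real (sqrt 2) * c + \<i> + \<i>)\<^sup>2 *
     ((of_real (sqrt 2) * c + \<i>)\<^sup>2 - 2 * \<i> * (of_real (sqrt 2) * c + \<i>) - 3) * (of_real (sqrt 2) * d)\<^sup>2) = - q'\<^sup>2"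
proof -
  define s where "s = complex_of_real (sqrt 2)"
  have s: "s * s = 2" unfolding s_def by (simp flip: of_real_mult)
  have i: "\<i> * \<i> = -1" by simp
  have 1: "(s * c + \<i> + \<i>)\<^sup>2 = - (2 - s * \<i> * c)\<^sup>2"
    using i by algebra
  have 2: "(s * c + \<i>)\<^sup>2 - 2 * \<i> * (s * c + \<i>) - 3 = - 2 * (1 - c\<^sup>2)"
  proof -
    have "(s * c + \<i>)\<^sup>2 - 2 * \<i> * (s * c + \<i>) - 3 = s * s * c\<^sup>2 - 2"
      by (simp add: power2_eq_square algebra_simps)
    then show ?thesis by (simp add: s algebra_simps)
  qed
  have 3: "(s * d)\<^sup>2 = 2 * d\<^sup>2" unfolding power_mult_distrib power2_eq_square[of s] s ..
  have 4: "- q'\<^sup>2 = - (D\<^sup>2 * d\<^sup>2)" using assms(2) by (simp flip: power_mult_distrib)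
  show ?thesis unfolding 4 assms(1) s_def[symmetric] 1 2 3 by (simp add: field_simps)
qed

theorem theorem2p1:
  fixes Q :: "complex \<Rightarrow> complex" and z\<^sub>1 z\<^sub>2 :: complex
  assumes Q: "Q = (\<lambda>z. - (1 / 4) * (z + \<i>)\<^sup>2 * (z\<^sup>2 - 2 * \<i> * z - 3))"
    and z1: "z\<^sub>1 = - complex_of_real (sqrt 2) + \<i>"
    and z2: "z\<^sub>2 = complex_of_real (sqrt 2) + \<i>"
  shows "{z. Q z = 0 \<and> zorder Q z = 1} = {z\<^sub>1, z\<^sub>2} \<and>
         (Q (- \<i>) = 0 \<and> zorder Q (- \<i>) = 2) \<and>
         (\<exists>\<gamma>. critical_trajectory_connecting Q z\<^sub>1 z\<^sub>2 \<gamma>)"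
proof -
  have fac: "Q z = - (1 / 4) * (z + \<i>)\<^sup>2 * ((z - z\<^sub>1) * (z - z\<^sub>2))" for z
  proof -
    have "z\<^sup>2 - 2 * \<i> * z - 3 = (z - z\<^sub>1) * (z - z\<^sub>2)" 
    proof -
      define s where "s = complex_of_real (sqrt 2)"
      have "(z - (- s + \<i>)) * (z - (s + \<i>)) = z\<^sup>2 - 2 * \<i> * z - 1 - s * s"
        by (simp add: power2_eq_square algebra_simps)
      moreover have "s * s = 2" unfolding s_def by (simp flip: of_real_mult)
      ultimately show ?thesis by (simp add: z1 z2 s_def)
    qed
    then show ?thesis by (simp add: Q)
  qed
  have ne: "z\<^sub>1 \<noteq> z\<^sub>2" "z\<^sub>1 \<noteq> - \<i>" "z\<^sub>2 \<noteq> - \<i>" by (auto simp: z1 z2 complex_eq_iff)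
  have o1: "zorder Q z\<^sub>1 = 1"
    by (rule zorder_eqI[of UNIV _ "\<lambda>z. - (1 / 4) * (z + \<i>)\<^sup>2 * (z - z\<^sub>2)"])
       (use ne in \<open>auto intro!: holomorphic_intros simp: fac add_eq_0_iff2\<close>)
  have o2: "zorder Q z\<^sub>2 = 1"
    by (rule zorder_eqI[of UNIV _ "\<lambda>z. - (1 / 4) * (z + \<i>)\<^sup>2 * (z - z\<^sub>1)"])
       (use ne in \<open>auto intro!: holomorphic_intros simp: fac add_eq_0_iff2\<close>)
  have o3: "zorder Q (- \<i>) = 2"
    by (rule zorder_eqI[of UNIV _ "\<lambda>z. - (1 / 4) * ((z - z\<^sub>1) * (z - z\<^sub>2))"])
       (use ne in \<open>auto intro!: holomorphic_intros simp: fac\<close>)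
  have zeros: "Q z = 0 \<longleftrightarrow> z = - \<i> \<or> z = z\<^sub>1 \<or> z = z\<^sub>2" for z
    by (auto simp: fac add_eq_0_iff2)
  have simple: "{z. Q z = 0 \<and> zorder Q z = 1} = {z\<^sub>1, z\<^sub>2}"
    using o1 o2 o3 by (auto simp: zeros)
  obtain H g f where H: "H holomorphic_on UNIV"
     "\<And>c. (deriv H c)\<^sup>2 = H c * (1 - H c) * (1 - c\<^sup>2) * (2 - of_real (sqrt 2) * \<i> * c)\<^sup>2"
    and g: "continuous_on {0..1} g" "g 0 = -1" "g 1 = 1"
      "\<And>t. t \<in> {0..1} \<Longrightarrow> H (g t) = of_real (smoothstep t)"
    and f: "f analytic_on complex_of_real ` {0..1}"
      "\<And>t. t \<in> {0..1} \<Longrightarrow> g t = f (of_real t)" "\<And>t. t \<in> {0..1} \<Longrightarrow> deriv f (of_real t) \<noteq> 0"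
    using normalized_arc by blast
  define \<gamma> where "\<gamma> = (\<lambda>t. of_real (sqrt 2) * g t + \<i>)"
  define e where "e = (\<lambda>z. of_real (sqrt 2) * f z + \<i>)"
  have e: "e analytic_on complex_of_real ` {0..1}"
    unfolding e_def by (intro analytic_intros f(1))
  have \<gamma>e: "\<forall>t\<in>{0..1}. \<gamma> t = e (of_real t)" using f(2) by (simp add: \<gamma>_def e_def)
  have df: "(f has_field_derivative deriv f (of_real t)) (at (of_real t))" if "t \<in> {0..1}" for t
    using that f(1) by (intro field_differentiable_derivI analytic_on_imp_differentiable_at) auto
  have de: "deriv e (of_real t) = of_real (sqrt 2) * deriv f (of_real t)" if "t \<in> {0..1}" for t
  proof -
    have "(e has_field_derivative of_real (sqrt 2) * deriv f (of_real t) + 0) (at (of_real t))"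
      unfolding e_def by (intro DERIV_add DERIV_cmult DERIV_const df that)
    then show ?thesis by (simp add: DERIV_imp_deriv)
  qed
  have path: "path \<gamma>" unfolding path_def \<gamma>_def by (intro continuous_intros g(1))
  have "inj_on \<gamma> {0..1}"
  proof (rule linorder_inj_onI')
    fix x y :: real assume xy: "x \<in> {0..1}" "y \<in> {0..1}" "x < y"
    then have "smoothstep x \<noteq> smoothstep y" using smoothstep_strict_mono[of x y] by auto
    then have "H (g x) \<noteq> H (g y)" using g(4) xy by (metis of_real_eq_iff)
    then show "\<gamma> x \<noteq> \<gamma> y" by (auto simp: \<gamma>_def)
  qed
  with path have "arc \<gamma>" by (simp add: arc_def)
  then have aarc: "analytic_arc \<gamma>"
    unfolding analytic_arc_def using e \<gamma>e de f(3) by (intro conjI exI[of _ e]) auto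
  have neg: "Q (\<gamma> t) * (vector_derivative \<gamma> (at t))\<^sup>2 \<in> \<real> \<and> Re (Q (\<gamma> t) * (vector_derivative \<gamma> (at t))\<^sup>2) < 0"
    if t: "t \<in> {0<..<1}" for t
  proof -
    have t01: "t \<in> {0..1}" using t by auto
    define q q' where "q = smoothstep t" and "q' = 30 * t\<^sup>2 * (1 - t)\<^sup>2"
    have q: "0 < q" "q < 1" using smoothstep_bounds(2)[OF t] by (auto simp: q_def)
    have "((\<lambda>z. H (f z)) has_field_derivative deriv H (f (of_real t)) * deriv f (of_real t)) (at (of_real t))"
      by (rule DERIV_chain2[OF holomorphic_derivI[OF H(1) open_UNIV UNIV_I] df[OF t01]])
    then have "((\<lambda>x. H (f (of_real x))) has_vector_derivative deriv H (f (of_real t)) * deriv f (of_real t)) (at t)"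
      by (rule has_vector_derivative_real_field)
    then have "((\<lambda>x. of_real (smoothstep x)) has_vector_derivative deriv H (f (of_real t)) * deriv f (of_real t)) (at t)"
      by (rule has_vector_derivative_transform_within_open[of _ _ _ "{0<..<1}"])
         (use t f(2) g(4) in \<open>auto simp: less_imp_le\<close>)
    moreover have "((\<lambda>x. of_real (smoothstep x)) has_vector_derivative complex_of_real q') (at t)"
      using has_vector_derivative_of_real[OF smoothstep_deriv[of t]]
      by (simp add: q'_def)
    ultimately have "deriv H (f (of_real t)) * deriv f (of_real t) = of_real q'"
      by (rule vector_derivative_unique_at)
    then have "deriv H (g t) * deriv f (of_real t) = of_real q'" using f(2)[OF t01] by simp
    from Q_along_arc[OF H(2)[of "g t"] this]
    have "of_real q * (1 - of_real q) * (Q (\<gamma> t) * (of_real (sqrt 2) * deriv f (of_real t))\<^sup>2) = - (complex_of_real q')\<^sup>2"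
      using g(4)[OF t01] unfolding Q \<gamma>_def q_def by simp
    moreover have "vector_derivative \<gamma> (at t) = of_real (sqrt 2) * deriv f (of_real t)"
      using vector_derivative_at[OF vector_derivative_of_real_comp[OF e \<gamma>e t]] de[OF t01] by simp
    ultimately have "of_real (q * (1 - q)) * (Q (\<gamma> t) * (vector_derivative \<gamma> (at t))\<^sup>2) = complex_of_real (- q'\<^sup>2)"
      by simp
    moreover have "q * (1 - q) > 0" using q by simp
    ultimately have "Q (\<gamma> t) * (vector_derivative \<gamma> (at t))\<^sup>2 = complex_of_real (- q'\<^sup>2 / (q * (1 - q)))"
      by (metis less_irrefl nonzero_mult_div_cancel_left of_real_divide of_real_eq_0_iff)
    moreover have "- q'\<^sup>2 / (q * (1 - q)) < 0" using t \<open>q * (1 - q) > 0\<close> by (simp add: q'_def)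
    ultimately show ?thesis by simp
  qed
  have traj: "trajectory Q \<gamma>" unfolding trajectory_def using aarc neg by blast
  have ends: "pathstart \<gamma> = z\<^sub>1" "pathfinish \<gamma> = z\<^sub>2"
    using g(2,3) by (simp_all add: pathstart_def pathfinish_def \<gamma>_def z1 z2)
  have Q0: "Q z\<^sub>1 = 0" "Q z\<^sub>2 = 0" using zeros by auto
  have "continuous_on UNIV Q" unfolding Q by (intro continuous_intros)
  then obtain R where R: "continuous_on (path_image \<gamma>) R" "\<forall>z\<in>path_image \<gamma>. (R z)\<^sup>2 = Q z"
    using trajectory_sqrt_branch[OF traj] Q0 ends by auto
  have "Q (\<gamma> t) \<noteq> 0" if "t \<in> {0<..<1}" for t using neg[OF that] by auto
  then have "critical_trajectory_connecting Q z\<^sub>1 z\<^sub>2 \<gamma>"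
    unfolding critical_trajectory_connecting_def
    using traj ends Q0 R trajectory_contour_integral_real[OF traj R(2)] by blast
  then show ?thesis using simple zeros o3 by blast
qed

end
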